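(* Let $\|\cdot\|$ be an admissible norm on $\mathbb{R}^3$ and let $f:M\to(\mathbb{R}^3,\|\cdot\|)$ be an immersed surface with Birkhoff-Gauss map $\eta$ and affine fundamental form $h$. Assume that $M$ has negative Minkowski Gaussian curvature $K$. Then $M$ is minimal (in the Minkowski sense) if and only if there exists a function $c:M\to\mathbb{R}$ such that $$h(d\eta_pX,d\eta_pY)=c(p)\cdot h(X,Y)$$ for any $p\in M$ and $X,Y\in T_pM$. In this case, $c(p)=-K(p)$ for each $p\in M$.
   Context: A norm $\|\cdot\|$ on $\mathbb{R}^3$ is admissible if its unit sphere $\partial B=\{x\in\mathbb{R}^3:\|x\|=1\}$ is a smooth surface of strictly positive Gaussian curvature in the usual Euclidean geometry of $\mathbb{R}^3$. A non-zero vector $v$ is Birkhoff orthogonal to a plane $P$ (through the origin), written $v\dashv_B P$, if $\|v+tw\|\ge\|v\|$ for all $t\in\mathbb{R}$, $w\in P$. Surfaces are smooth and orientable, immersions are smooth, and $M$ is identified with its image, $T_pM$ being regarded as a plane in $\mathbb{R}^3$. The Birkhoff-Gauss map $\eta:M\to\partial B$ is a globally defined smooth map with $\eta(p)\dashv_B T_pM$ for all $p$ (one of the two choices is fixed). Since $T_{\eta(p)}\partial B$ is parallel to $T_pM$, $d\eta_p$ is an endomorphism of $T_pM$. The Minkowski Gaussian curvature is $K(p)=\det(d\eta_p)$ and the Minkowski mean curvature is $H(p)=\frac12\mathrm{tr}(d\eta_p)$. $M$ is minimal (in the Minkowski sense) if $H$ vanishes everywhere. The affine fundamental form $h$ is the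 bilinear form on $TM$ defined by the Gauss formula $D_XY=\nabla_XY+h(X,Y)\eta$, where $D$ is the standard connection of $\mathbb{R}^3$, $X,Y$ are tangent vector fields and $\nabla_XY$ is tangent to $M$. Equivalently, $h(X,Y)=\langle D_XY,\xi\rangle/\langle\eta,\xi\rangle$, where $\xi$ is the Euclidean Gauss map (unit normal) of $M$ and $\langle\cdot,\cdot\rangle$ the usual inner product. *)

theory Defs
  imports "HOL-Analysis.Analysis"
begin

section \<open>Smooth maps between normed spaces\<close>

primrec Ck_on :: "nat \<Rightarrow> 'a::real_normed_vector set \<Rightarrow> ('a \<Rightarrow> 'b::real_normed_vector) \<Rightarrow> bool" where
  "Ck_on 0 S f \<longleftrightarrow> continuous_on S f"
| "Ck_on (Suc k) S f \<longleftrightarrow> (\<forall>x\<in>S. f differentiable (at x)) \<and>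
     (\<forall>v. Ck_on k S (\<lambda>x. frechet_derivative f (at x) v))"

text \<open>This is only used for open \<open>S\<close> in a finite-dimensional space.\<close>

definition smooth_on :: "'a::real_normed_vector set \<Rightarrow> ('a \<Rightarrow> 'b::real_normed_vector) \<Rightarrow> bool" where
  "smooth_on S f \<longleftrightarrow> (\<forall>k. Ck_on k S f)"


section \<open>Smooth surfaces\<close>

text \<open>A surface is a set \<open>M\<close> with the subspace topology of a second countable Hausdorff space,
  together with an atlas. A chart \<open>(U, x)\<close> consists of its domain and the coordinate map;
  \<open>inv_into U x\<close> is the corresponding local parametrization.\<close>

type_synonym 'm chart = "'m set \<times> ('m \<Rightarrow> real^2)"

definition smooth_atlas :: "'m::{t2_space,second_countable_topology} set \<Rightarrow> 'm chart set \<Rightarrow> bool" where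
  "smooth_atlas M A \<longleftrightarrow>
     M = (\<Union>(U, x)\<in>A. U) \<and>
     (\<forall>(U, x)\<in>A. openin (top_of_set M) U \<and> open (x ` U) \<and>
        homeomorphism U (x ` U) x (inv_into U x)) \<and>
     (\<forall>(U, x)\<in>A. \<forall>(V, y)\<in>A. smooth_on (x ` (U \<inter> V)) (y \<circ> inv_into U x))"

definition orientable_atlas :: "'m::{t2_space,second_countable_topology} set \<Rightarrow> 'm chart set \<Rightarrow> bool" where
  "orientable_atlas M A \<longleftrightarrow>
     (\<exists>B. smooth_atlas M B \<and> smooth_atlas M (A \<union> B) \<and>
        (\<forall>(U, x)\<in>B. \<forall>(V, y)\<in>B. \<forall>z\<in>x ` (U \<inter> V).
           0 < det (matrix (frechet_derivative (y \<circ> inv_into U x) (at z)))))"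

text \<open>Smoothness of a map into a normed space on a (relatively open) part \<open>W\<close> of the surface.\<close>

definition smooth_map ::
  "'m chart set \<Rightarrow> 'm set \<Rightarrow> ('m \<Rightarrow> 'b::real_normed_vector) \<Rightarrow> bool" where
  "smooth_map A W g \<longleftrightarrow> (\<forall>(U, x)\<in>A. smooth_on (x ` (U \<inter> W)) (g \<circ> inv_into U x))"

definition chart_deriv ::
  "'m chart \<Rightarrow> ('m \<Rightarrow> 'b::real_normed_vector) \<Rightarrow> 'm \<Rightarrow> real^2 \<Rightarrow> 'b" where
  "chart_deriv C g p =
     frechet_derivative (g \<circ> inv_into (fst C) (snd C)) (at (snd C p))"

definition immersed_surface ::
  "'m::{t2_space,second_countable_topology} set \<Rightarrow> 'm chart set \<Rightarrow> ('m \<Rightarrow> real^3) \<Rightarrow> bool" where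
  "immersed_surface M A f \<longleftrightarrow>
     smooth_atlas M A \<and> orientable_atlas M A \<and> smooth_map A M f \<and>
     (\<forall>C\<in>A. \<forall>p\<in>fst C. inj (chart_deriv C f p))"

text \<open>The tangent space at \<open>p\<close> is identified with its image under the differential of \<open>f\<close>.
  It is indexed by the point of \<open>M\<close>, since \<open>f\<close> need not be injective.\<close>

definition tangent_plane :: "'m chart set \<Rightarrow> ('m \<Rightarrow> real^3) \<Rightarrow> 'm \<Rightarrow> (real^3) set" where
  "tangent_plane A f p = (\<Union>C\<in>{C\<in>A. p \<in> fst C}. range (chart_deriv C f p))"

text \<open>The differential \<open>dg\<^sub>p\<close> of a map \<open>g\<close> on \<open>M\<close>, as a map on \<open>tangent_plane A f p\<close>. By the chain
  rule its value does not depend on the chart. This is also the derivative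
  \<open>D\<^sub>v g\<close> of a vector field \<open>g\<close> along the immersion.\<close>

definition differential ::
  "'m chart set \<Rightarrow> ('m \<Rightarrow> real^3) \<Rightarrow> ('m \<Rightarrow> 'b::real_normed_vector) \<Rightarrow> 'm \<Rightarrow> real^3 \<Rightarrow> 'b" where
  "differential A f g p v =
     (THE u. \<exists>C\<in>A. p \<in> fst C \<and>
        (\<exists>w. chart_deriv C f p w = v \<and> chart_deriv C g p w = u))"


section \<open>Trace and determinant of an endomorphism of a plane\<close>

text \<open>The matrix of \<open>L : P \<rightarrow> P\<close> with respect to some basis \<open>E e\<^sub>1, E e\<^sub>2\<close> of the plane \<open>P\<close>;
  its trace and determinant do not depend on the choice.\<close>

definition matrix_on :: "'a::real_vector set \<Rightarrow> ('a \<Rightarrow> 'a) \<Rightarrow> real^2^2" where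
  "matrix_on P L =
     (SOME Q. \<exists>E :: real^2 \<Rightarrow> 'a. linear E \<and> inj E \<and> range E = P \<and>
        (\<forall>w. L (E w) = E (Q *v w)))"

definition det_on :: "'a::real_vector set \<Rightarrow> ('a \<Rightarrow> 'a) \<Rightarrow> real" where
  "det_on P L = det (matrix_on P L)"

definition trace_on :: "'a::real_vector set \<Rightarrow> ('a \<Rightarrow> 'a) \<Rightarrow> real" where
  "trace_on P L = trace (matrix_on P L)"


section \<open>Admissible norms\<close>

definition is_norm :: "('a::real_vector \<Rightarrow> real) \<Rightarrow> bool" where
  "is_norm N \<longleftrightarrow>
     (\<forall>x. 0 \<le> N x) \<and> (\<forall>x. N x = 0 \<longleftrightarrow> x = 0) \<and>
     (\<forall>a x. N (a *\<^sub>R x) = \<bar>a\<bar> * N x) \<and> (\<forall>x y. N (x + y) \<le> N x + N y)"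

definition unit_sphere :: "('a \<Rightarrow> real) \<Rightarrow> 'a set" where
  "unit_sphere N = {x. N x = 1}"

definition euclidean_gauss_map ::
  "'m set \<Rightarrow> 'm chart set \<Rightarrow> ('m \<Rightarrow> real^3) \<Rightarrow> ('m \<Rightarrow> real^3) \<Rightarrow> bool" where
  "euclidean_gauss_map M A f \<xi> \<longleftrightarrow> smooth_map A M \<xi> \<and>
     (\<forall>p\<in>M. norm (\<xi> p) = 1 \<and> (\<forall>v\<in>tangent_plane A f p. \<xi> p \<bullet> v = 0))"

text \<open>The Euclidean Gaussian curvature is \<open>det d\<xi>\<^sub>p\<close>, which is unaffected by the choice of sign of
  the unit normal \<open>\<xi>\<close>. The inclusion of the unit sphere, which carries the
  topology of \<open>real^3\<close>, is required to be an immersion, so that the sphere is an embedded surface.\<close>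

definition admissible_norm :: "(real^3 \<Rightarrow> real) \<Rightarrow> bool" where
  "admissible_norm N \<longleftrightarrow> is_norm N \<and>
     (\<exists>A \<xi>. immersed_surface (unit_sphere N) A (\<lambda>x. x) \<and>
        euclidean_gauss_map (unit_sphere N) A (\<lambda>x. x) \<xi> \<and>
        (\<forall>p\<in>unit_sphere N.
           0 < det_on (tangent_plane A (\<lambda>x. x) p) (differential A (\<lambda>x. x) \<xi> p)))"


section \<open>Minkowski geometry of immersed surfaces\<close>

definition birkhoff_orthogonal :: "('a::real_vector \<Rightarrow> real) \<Rightarrow> 'a \<Rightarrow> 'a set \<Rightarrow> bool" where
  "birkhoff_orthogonal N v P \<longleftrightarrow> v \<noteq> 0 \<and> (\<forall>t. \<forall>w\<in>P. N (v + t *\<^sub>R w) \<ge> N v)"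

definition birkhoff_gauss_map ::
  "(real^3 \<Rightarrow> real) \<Rightarrow> 'm set \<Rightarrow> 'm chart set \<Rightarrow> ('m \<Rightarrow> real^3) \<Rightarrow> ('m \<Rightarrow> real^3) \<Rightarrow> bool" where
  "birkhoff_gauss_map N M A f \<eta> \<longleftrightarrow> smooth_map A M \<eta> \<and>
     (\<forall>p\<in>M. \<eta> p \<in> unit_sphere N \<and> birkhoff_orthogonal N (\<eta> p) (tangent_plane A f p))"

definition minkowski_gauss_curvature ::
  "'m chart set \<Rightarrow> ('m \<Rightarrow> real^3) \<Rightarrow> ('m \<Rightarrow> real^3) \<Rightarrow> 'm \<Rightarrow> real" where
  "minkowski_gauss_curvature A f \<eta> p = det_on (tangent_plane A f p) (differential A f \<eta> p)"

definition minkowski_mean_curvature ::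
  "'m chart set \<Rightarrow> ('m \<Rightarrow> real^3) \<Rightarrow> ('m \<Rightarrow> real^3) \<Rightarrow> 'm \<Rightarrow> real" where
  "minkowski_mean_curvature A f \<eta> p = trace_on (tangent_plane A f p) (differential A f \<eta> p) / 2"

definition minkowski_minimal ::
  "'m set \<Rightarrow> 'm chart set \<Rightarrow> ('m \<Rightarrow> real^3) \<Rightarrow> ('m \<Rightarrow> real^3) \<Rightarrow> bool" where
  "minkowski_minimal M A f \<eta> \<longleftrightarrow> (\<forall>p\<in>M. minkowski_mean_curvature A f \<eta> p = 0)"

definition tangent_field_on ::
  "'m chart set \<Rightarrow> ('m \<Rightarrow> real^3) \<Rightarrow> 'm set \<Rightarrow> ('m \<Rightarrow> real^3) \<Rightarrow> bool" where
  "tangent_field_on A f W Z \<longleftrightarrow> smooth_map A W Z \<and> (\<forall>q\<in>W. Z q \<in> tangent_plane A f q)"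

text \<open>The value \<open>h(X, Y)\<close> at \<open>p\<close> is the transversal coefficient in the Gauss formula
  \<open>D\<^sub>X Z = \<nabla>\<^sub>X Z + h(X, Z) \<eta>\<close>, for every tangent field \<open>Z\<close> near \<open>p\<close> extending \<open>Y\<close>.\<close>

definition affine_form ::
  "'m::topological_space set \<Rightarrow> 'm chart set \<Rightarrow> ('m \<Rightarrow> real^3) \<Rightarrow> ('m \<Rightarrow> real^3) \<Rightarrow>
     'm \<Rightarrow> real^3 \<Rightarrow> real^3 \<Rightarrow> real" where
  "affine_form M A f \<eta> p X Y =
     (THE a. \<forall>W Z. openin (top_of_set M) W \<and> p \<in> W \<and> tangent_field_on A f W Z \<and> Z p = Y \<longrightarrow>
        differential A f Z p X - a *\<^sub>R \<eta> p \<in> tangent_plane A f p)"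

end

theory Submission
  imports Defs
begin

text \<open>
Everything happens at one point \<open>p\<close>, in the plane \<open>P = T\<^sub>p M\<close>. Write \<open>L = d\<eta>\<^sub>p\<close>; it maps \<open>P\<close> to
itself. Two facts about the form \<open>h\<close> carry the proof.

First, \<open>h\<close> is symmetric and \<open>L\<close> is self-adjoint for it. If \<open>\<xi>\<close> is the unit normal along \<open>M\<close>, both
\<open>f\<^sub>i\<close> and \<open>\<eta>\<^sub>i\<close> (coordinate derivatives) are orthogonal to \<open>\<xi>\<close>, so differentiating once more turns
\<open>\<langle>f\<^sub>i, \<xi>\<^sub>j\<rangle>\<close> and \<open>\<langle>\<eta>\<^sub>i, \<xi>\<^sub>j\<rangle>\<close> into \<open>-\<langle>f\<^sub>i\<^sub>j, \<xi>\<rangle>\<close> and \<open>-\<langle>\<eta>\<^sub>i\<^sub>j, \<xi>\<rangle>\<close>, which are symmetric in \<open>i\<close> and \<open>j\<close>.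
As \<open>h\<^sub>i\<^sub>j = -\<langle>f\<^sub>i, \<xi>\<^sub>j\<rangle> / \<langle>\<eta>, \<xi>\<rangle>\<close>, the first symmetry is that of \<open>h\<close> and the second says
\<open>h(LX, Y) = h(X, LY)\<close> (lemma \<open>normal_derivative_symmetric\<close>).

Second, \<open>h\<close> is nondegenerate where \<open>K \<noteq> 0\<close>. Birkhoff orthogonality means that \<open>P\<close> supports the unit
ball at \<open>\<eta>(p)\<close>, so that \<open>P\<close> is also the tangent plane of the unit sphere there
(\<open>unit_sphere_tangent_plane_eq\<close>). Hence one may take \<open>\<xi> = u \<circ> \<eta>\<close> with the Euclidean Gauss map \<open>u\<close> of the unit
sphere, and \<open>d\<xi> = du \<circ> L\<close>. The positive Gaussian curvature of the sphere makes \<open>du\<close> injective on \<open>P\<close>,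
and \<open>det L = K\<close>.

With these, \<open>h(LX, LY) = c h(X, Y)\<close> for all \<open>X, Y\<close> is the same as \<open>L\<^sup>2 = c I\<close>. By Cayley-Hamilton
\<open>L\<^sup>2 = 2 H L - K I\<close>, so \<open>H = 0\<close> gives it with \<open>c = -K\<close>. Conversely \<open>2 H L = (c + K) I\<close>; if \<open>H \<noteq> 0\<close>, then \<open>L\<close>
is a multiple of the identity and \<open>K = det L\<close> is a square, contrary to \<open>K < 0\<close>. So \<open>H = 0\<close>, and then
\<open>c = -K\<close> (\<open>self_adjoint_conformal_iff\<close>).
\<close>

section \<open>Differential calculus\<close>

lemma Ck_on_cong:
  assumes "open S" "\<And>x. x \<in> S \<Longrightarrow> f x = g x" "Ck_on k S f"
  shows "Ck_on k S g"
  using assms(2,3)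
proof (induction k arbitrary: f g)
  case 0
  then show ?case
    using continuous_on_cong[of S S f g] by simp
next
  case (Suc k)
  have d: "(g has_derivative frechet_derivative f (at x)) (at x)" if "x \<in> S" for x
    using Suc.prems that assms(1)
    by (auto intro: has_derivative_transform_within_open[where f = f] simp: frechet_derivative_works[symmetric])
  then have eq: "frechet_derivative f (at x) = frechet_derivative g (at x)" if "x \<in> S" for x
    using that frechet_derivative_at by blast
  have "Ck_on k S (\<lambda>x. frechet_derivative g (at x) v)" for v
    by (rule Suc.IH[where f = "\<lambda>x. frechet_derivative f (at x) v"]) (use Suc.prems eq in auto)
  with d show ?case
    by (auto simp: differentiable_def)
qed

lemma Ck_on_SucD: "Ck_on (Suc k) S f \<Longrightarrow> Ck_on k S f"
proof (induction k arbitrary: f)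
  case 0
  then show ?case
    by (auto simp: continuous_on_eq_continuous_within
        intro: differentiable_imp_continuous_within differentiable_within_subset)
next
  case (Suc k)
  then show ?case
    by (metis Ck_on.simps(2))
qed

text \<open>Lets the inductions below work with derivatives computed by the usual rules instead of
  \<open>frechet_derivative\<close>.\<close>

lemma Ck_on_Suc_iff_derivative:
  assumes "open S" "\<And>x. x \<in> S \<Longrightarrow> (f has_derivative f' x) (at x)"
  shows "Ck_on (Suc k) S f \<longleftrightarrow> (\<forall>v. Ck_on k S (\<lambda>x. f' x v))"
proof -
  have eq: "f' x = frechet_derivative f (at x)" if "x \<in> S" for x
    using assms(2)[OF that] frechet_derivative_at by blast
  have "Ck_on k S (\<lambda>x. f' x v) \<longleftrightarrow> Ck_on k S (\<lambda>x. frechet_derivative f (at x) v)" for v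
    using Ck_on_cong[OF assms(1), of "\<lambda>x. f' x v" "\<lambda>x. frechet_derivative f (at x) v"]
      Ck_on_cong[OF assms(1), of "\<lambda>x. frechet_derivative f (at x) v" "\<lambda>x. f' x v"] eq
    by auto
  with assms(2) show ?thesis
    by (auto simp: differentiable_def)
qed

lemma Ck_on_has_derivative:
  assumes "Ck_on (Suc k) S f" "x \<in> S"
  shows "(f has_derivative frechet_derivative f (at x)) (at x)"
  using assms by (simp add: frechet_derivative_works[symmetric])

lemma Ck_on_add:
  assumes "open S"
  shows "Ck_on k S f \<Longrightarrow> Ck_on k S g \<Longrightarrow> Ck_on k S (\<lambda>x. f x + g x)"
proof (induction k arbitrary: f g)
  case 0
  then show ?case by (auto intro: continuous_intros)
next
  case (Suc k)
  have "((\<lambda>x. f x + g x) has_derivative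
      (\<lambda>v. frechet_derivative f (at x) v + frechet_derivative g (at x) v)) (at x)" if "x \<in> S" for x
    using Suc.prems that by (auto intro!: derivative_intros Ck_on_has_derivative)
  from Ck_on_Suc_iff_derivative[OF assms this] show ?case
    using Suc by auto
qed

lemma Ck_on_const: "Ck_on k S (\<lambda>x. c)"
  by (induction k arbitrary: c) auto

lemma Ck_on_sum:
  assumes "open S" "finite I" "\<And>i. i \<in> I \<Longrightarrow> Ck_on k S (f i)"
  shows "Ck_on k S (\<lambda>x. \<Sum>i\<in>I. f i x)"
  using assms(2,3) by induction (auto intro: Ck_on_const Ck_on_add[OF assms(1)])

lemma Ck_on_bounded_linear:
  assumes "open S" "bounded_linear l"
  shows "Ck_on k S f \<Longrightarrow> Ck_on k S (\<lambda>x. l (f x))"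
proof (induction k arbitrary: f)
  case 0
  then show ?case
    using assms(2) by (auto intro: bounded_linear.continuous_on)
next
  case (Suc k)
  have "((\<lambda>x. l (f x)) has_derivative (\<lambda>v. l (frechet_derivative f (at x) v))) (at x)"
    if "x \<in> S" for x
    using Suc.prems that by (auto intro!: bounded_linear.has_derivative[OF assms(2)] Ck_on_has_derivative)
  from Ck_on_Suc_iff_derivative[OF assms(1) this] show ?case
    using Suc by auto
qed

lemma Ck_on_scaleR:
  assumes "open S"
  shows "Ck_on k S f \<Longrightarrow> Ck_on k S g \<Longrightarrow> Ck_on k S (\<lambda>x. f x *\<^sub>R g x)"
proof (induction k arbitrary: f g)
  case 0
  then show ?case by (auto intro: continuous_intros)
next
  case (Suc k)
  have "((\<lambda>x. f x *\<^sub>R g x) has_derivative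
      (\<lambda>v. f x *\<^sub>R frechet_derivative g (at x) v + frechet_derivative f (at x) v *\<^sub>R g x)) (at x)"
    if "x \<in> S" for x
    using Suc.prems that by (auto intro!: derivative_intros Ck_on_has_derivative)
  from Ck_on_Suc_iff_derivative[OF assms this] show ?case
    using Suc Ck_on_SucD[OF Suc.prems(1)] Ck_on_SucD[OF Suc.prems(2)]
    by (auto intro!: Ck_on_add[OF assms])
qed

text \<open>The chain rule writes the directional derivative of \<open>g \<circ> f\<close> as a finite sum of products of a component
  of a derivative of \<open>f\<close> with a fixed directional derivative of \<open>g\<close> composed with \<open>f\<close>. Each factor
  has one degree of smoothness less, so the induction hypothesis and the product rule apply.\<close>

lemma Ck_on_compose:
  fixes f :: "'a::real_normed_vector \<Rightarrow> 'b::euclidean_space"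
  assumes "open S" "open T" "f ` S \<subseteq> T"
  shows "Ck_on k S f \<Longrightarrow> Ck_on k T g \<Longrightarrow> Ck_on k S (g \<circ> f)"
proof (induction k arbitrary: g)
  case 0
  then show ?case
    using continuous_on_compose[of S f g] continuous_on_subset[OF _ assms(3), of g] by simp
next
  case (Suc k)
  let ?f' = "\<lambda>x. frechet_derivative f (at x)"
  let ?g' = "\<lambda>y. frechet_derivative g (at y)"
  have g': "(g has_derivative ?g' (f x)) (at (f x))" if "x \<in> S" for x
    using Suc.prems(2) that assms(3) by (auto intro!: Ck_on_has_derivative)
  have "(g \<circ> f has_derivative (\<lambda>v. \<Sum>i\<in>Basis. (?f' x v \<bullet> i) *\<^sub>R ?g' (f x) i)) (at x)"
    if "x \<in> S" for x
  proof -
    have "(g \<circ> f has_derivative ?g' (f x) \<circ> ?f' x) (at x)"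
      using Ck_on_has_derivative[OF Suc.prems(1) that] g'[OF that] by (rule diff_chain_at)
    moreover have "?g' (f x) w = (\<Sum>i\<in>Basis. (w \<bullet> i) *\<^sub>R ?g' (f x) i)" for w
    proof -
      have l: "linear (?g' (f x))"
        using g'[OF that] by (rule has_derivative_linear)
      have "?g' (f x) w = ?g' (f x) (\<Sum>i\<in>Basis. (w \<bullet> i) *\<^sub>R i)"
        by (simp add: euclidean_representation)
      also have "\<dots> = (\<Sum>i\<in>Basis. (w \<bullet> i) *\<^sub>R ?g' (f x) i)"
        by (simp add: linear_sum[OF l] linear_scale[OF l])
      finally show ?thesis .
    qed
    then have "?g' (f x) \<circ> ?f' x = (\<lambda>v. \<Sum>i\<in>Basis. (?f' x v \<bullet> i) *\<^sub>R ?g' (f x) i)"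
      unfolding comp_def by (intro ext)
    ultimately show ?thesis
      by simp
  qed
  note Suc_iff = Ck_on_Suc_iff_derivative[OF assms(1) this]
  have "Ck_on k S (\<lambda>x. \<Sum>i\<in>Basis. (?f' x v \<bullet> i) *\<^sub>R ?g' (f x) i)" for v
  proof (intro Ck_on_sum Ck_on_scaleR assms(1) finite_Basis)
    fix i :: 'b
    show "Ck_on k S (\<lambda>x. ?f' x v \<bullet> i)"
      using Suc.prems(1) by (intro Ck_on_bounded_linear[OF assms(1) bounded_linear_inner_left]) simp
    have "Ck_on k S ((\<lambda>y. ?g' y i) \<circ> f)"
      using Suc.prems(2) by (intro Suc.IH Ck_on_SucD[OF Suc.prems(1)]) simp
    then show "Ck_on k S (\<lambda>x. ?g' (f x) i)"
      by (simp add: comp_def)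
  qed
  then show ?case
    by (intro Suc_iff[THEN iffD2] allI)
qed

text \<open>The mean value theorem, used once in direction \<open>u\<close> and once in direction \<open>v\<close>. The left-hand side is
  symmetric in \<open>u\<close> and \<open>v\<close>, which is how the order of differentiation gets exchanged.\<close>

lemma mixed_difference_eq:
  fixes f :: "'a::real_normed_vector \<Rightarrow> real"
  assumes "0 < s"
    and mem: "\<And>a b. 0 \<le> a \<Longrightarrow> a \<le> s \<Longrightarrow> 0 \<le> b \<Longrightarrow> b \<le> s \<Longrightarrow> x + a *\<^sub>R u + b *\<^sub>R v \<in> S"
    and f': "\<And>y. y \<in> S \<Longrightarrow> (f has_derivative f' y) (at y)"
    and f'': "\<And>y. y \<in> S \<Longrightarrow> ((\<lambda>y. f' y u) has_derivative f'' y) (at y)"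
  obtains a b where "0 < a" "a < s" "0 < b" "b < s"
    "f (x + s *\<^sub>R u + s *\<^sub>R v) - f (x + s *\<^sub>R u) - f (x + s *\<^sub>R v) + f x
       = s * s * f'' (x + a *\<^sub>R u + b *\<^sub>R v) v"
proof -
  have d1: "((\<lambda>a. f (x + a *\<^sub>R u + b *\<^sub>R v)) has_real_derivative f' (x + a *\<^sub>R u + b *\<^sub>R v) u) (at a)"
    if "0 \<le> a" "a \<le> s" "0 \<le> b" "b \<le> s" for a b
  proof -
    have "(f \<circ> (\<lambda>a. x + a *\<^sub>R u + b *\<^sub>R v) has_derivative
        f' (x + a *\<^sub>R u + b *\<^sub>R v) \<circ> (\<lambda>h. h *\<^sub>R u)) (at a)"
      using mem[OF that] by (intro diff_chain_at f') (auto intro!: derivative_eq_intros)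
    moreover have "f' (x + a *\<^sub>R u + b *\<^sub>R v) (h *\<^sub>R u) = f' (x + a *\<^sub>R u + b *\<^sub>R v) u * h" for h
      using linear_scale[OF has_derivative_linear[OF f'[OF mem[OF that]]]] by simp
    ultimately show ?thesis
      by (simp add: has_field_derivative_def comp_def)
  qed
  have d2: "((\<lambda>b. f' (x + a *\<^sub>R u + b *\<^sub>R v) u) has_real_derivative f'' (x + a *\<^sub>R u + b *\<^sub>R v) v) (at b)"
    if "0 \<le> a" "a \<le> s" "0 \<le> b" "b \<le> s" for a b
  proof -
    have "((\<lambda>y. f' y u) \<circ> (\<lambda>b. x + a *\<^sub>R u + b *\<^sub>R v) has_derivative
        f'' (x + a *\<^sub>R u + b *\<^sub>R v) \<circ> (\<lambda>h. h *\<^sub>R v)) (at b)"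
      using mem[OF that] by (intro diff_chain_at f'') (auto intro!: derivative_eq_intros)
    moreover have "f'' (x + a *\<^sub>R u + b *\<^sub>R v) (h *\<^sub>R v) = f'' (x + a *\<^sub>R u + b *\<^sub>R v) v * h" for h
      using linear_scale[OF has_derivative_linear[OF f''[OF mem[OF that]]]] by simp
    ultimately show ?thesis
      by (simp add: has_field_derivative_def comp_def)
  qed
  define g where "g a = f (x + a *\<^sub>R u + s *\<^sub>R v) - f (x + a *\<^sub>R u)" for a
  have "(g has_real_derivative f' (x + a *\<^sub>R u + s *\<^sub>R v) u - f' (x + a *\<^sub>R u) u) (at a)"
    if "0 \<le> a" "a \<le> s" for a
    unfolding g_def using d1[of a s] d1[of a 0] that assms(1) by (auto intro!: DERIV_diff)
  from MVT2[of 0 s g, OF assms(1) this] obtain a where a: "0 < a" "a < s"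
    and "g s - g 0 = (s - 0) * (f' (x + a *\<^sub>R u + s *\<^sub>R v) u - f' (x + a *\<^sub>R u) u)"
    by blast
  moreover from MVT2[of 0 s "\<lambda>b. f' (x + a *\<^sub>R u + b *\<^sub>R v) u", OF assms(1) d2] a
  obtain b where b: "0 < b" "b < s"
    and "f' (x + a *\<^sub>R u + s *\<^sub>R v) u - f' (x + a *\<^sub>R u + 0 *\<^sub>R v) u
          = (s - 0) * f'' (x + a *\<^sub>R u + b *\<^sub>R v) v"
    by auto
  ultimately have "g s - g 0 = s * s * f'' (x + a *\<^sub>R u + b *\<^sub>R v) v"
    by simp
  then show thesis
    using that a b by (simp add: g_def)
qed

text \<open>The second difference over a small parallelogram equals \<open>s\<^sup>2\<close> times each of the two mixed
  derivatives at suitable nearby points; by continuity the derivatives agree in the limit.\<close>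

lemma symmetric_second_derivative_real:
  fixes f :: "'a::real_normed_vector \<Rightarrow> real"
  assumes "open S" "x \<in> S" "Ck_on (Suc (Suc 0)) S f"
  shows "frechet_derivative (\<lambda>y. frechet_derivative f (at y) u) (at x) v
       = frechet_derivative (\<lambda>y. frechet_derivative f (at y) v) (at x) u"
proof (rule ccontr)
  define f'' where "f'' u y v = frechet_derivative (\<lambda>y. frechet_derivative f (at y) u) (at y) v" for u y v
  assume ne: "\<not> ?thesis"
  define e where "e = \<bar>f'' u x v - f'' v x u\<bar> / 2"
  have "0 < e"
    using ne by (simp add: e_def f''_def)
  have c: "continuous (at x) (\<lambda>y. f'' u y v)" for u v
    using assms unfolding f''_def by (auto simp: continuous_on_eq_continuous_at)
  obtain r where "0 < r" and r: "ball x r \<subseteq> S"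
    using assms(1,2) open_contains_ball by blast
  obtain r1 where "0 < r1" and r1: "\<And>y. dist y x < r1 \<Longrightarrow> \<bar>f'' u y v - f'' u x v\<bar> < e"
    using c[of u v] \<open>0 < e\<close> unfolding continuous_at_eps_delta dist_real_def by metis
  obtain r2 where "0 < r2" and r2: "\<And>y. dist y x < r2 \<Longrightarrow> \<bar>f'' v y u - f'' v x u\<bar> < e"
    using c[of v u] \<open>0 < e\<close> unfolding continuous_at_eps_delta dist_real_def by metis
  define d where "d = min r (min r1 r2)"
  define s where "s = d / (norm u + norm v + 1)"
  have "0 < d" "0 < s"
    using \<open>0 < r\<close> \<open>0 < r1\<close> \<open>0 < r2\<close> by (auto simp: d_def s_def add_nonneg_pos)
  have near: "dist (x + a *\<^sub>R u + b *\<^sub>R v) x < d" if "0 \<le> a" "a \<le> s" "0 \<le> b" "b \<le> s" for a b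
  proof -
    have "dist (x + a *\<^sub>R u + b *\<^sub>R v) x \<le> a * norm u + b * norm v"
      using norm_triangle_ineq[of "a *\<^sub>R u" "b *\<^sub>R v"] that by (simp add: dist_norm add.assoc)
    also have "\<dots> \<le> s * norm u + s * norm v"
      using that by (intro add_mono mult_right_mono) auto
    also have "\<dots> < s * (norm u + norm v + 1)"
      using \<open>0 < s\<close> by (simp add: algebra_simps)
    also have "\<dots> = d"
      using add_nonneg_pos[of "norm u + norm v" 1] by (simp add: s_def)
    finally show ?thesis .
  qed
  have S: "x + a *\<^sub>R u + b *\<^sub>R v \<in> S" if "0 \<le> a" "a \<le> s" "0 \<le> b" "b \<le> s" for a b
    using near[OF that] r by (auto simp: d_def dist_commute)
  have D: "(f has_derivative frechet_derivative f (at y)) (at y)" if "y \<in> S" for y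
    using assms(3) that by (rule Ck_on_has_derivative)
  have D2: "((\<lambda>y. frechet_derivative f (at y) w) has_derivative f'' w y) (at y)" if "y \<in> S" for y w
    unfolding f''_def using assms(3) that by (intro Ck_on_has_derivative[of 0 S]) auto
  have S': "x + a *\<^sub>R v + b *\<^sub>R u \<in> S" if "0 \<le> a" "a \<le> s" "0 \<le> b" "b \<le> s" for a b
    using S[of b a] that by (simp add: add_ac)
  let ?f' = "\<lambda>y. frechet_derivative f (at y)"
  obtain a b where ab: "0 < a" "a < s" "0 < b" "b < s" and
    1: "f (x + s *\<^sub>R u + s *\<^sub>R v) - f (x + s *\<^sub>R u) - f (x + s *\<^sub>R v) + f x
       = s * s * f'' u (x + a *\<^sub>R u + b *\<^sub>R v) v"
    using mixed_difference_eq[where f' = ?f' and f'' = "f'' u", OF \<open>0 < s\<close> S D D2] by blast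
  obtain a' b' where ab': "0 < a'" "a' < s" "0 < b'" "b' < s" and
    2: "f (x + s *\<^sub>R v + s *\<^sub>R u) - f (x + s *\<^sub>R v) - f (x + s *\<^sub>R u) + f x
       = s * s * f'' v (x + a' *\<^sub>R v + b' *\<^sub>R u) u"
    using mixed_difference_eq[where f' = ?f' and f'' = "f'' v", OF \<open>0 < s\<close> S' D D2] by blast
  have swap: "x + s *\<^sub>R v + s *\<^sub>R u = x + s *\<^sub>R u + s *\<^sub>R v"
    by (simp add: add_ac)
  have "s * s * f'' u (x + a *\<^sub>R u + b *\<^sub>R v) v = s * s * f'' v (x + a' *\<^sub>R v + b' *\<^sub>R u) u"
    using 1 2 unfolding swap by linarith
  then have "f'' u (x + a *\<^sub>R u + b *\<^sub>R v) v = f'' v (x + b' *\<^sub>R u + a' *\<^sub>R v) u"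
    using \<open>0 < s\<close> by (simp add: add_ac)
  moreover have "\<bar>f'' u (x + a *\<^sub>R u + b *\<^sub>R v) v - f'' u x v\<bar> < e"
    using near[of a b] ab by (intro r1) (auto simp: d_def)
  moreover have "\<bar>f'' v (x + b' *\<^sub>R u + a' *\<^sub>R v) u - f'' v x u\<bar> < e"
    using near[of b' a'] ab' by (intro r2) (auto simp: d_def)
  ultimately have "\<bar>f'' u x v - f'' v x u\<bar> < e + e"
    by linarith
  then show False
    by (simp add: e_def)
qed

lemma symmetric_second_derivative:
  fixes f :: "'a::real_normed_vector \<Rightarrow> 'b::euclidean_space"
  assumes "open S" "x \<in> S" "Ck_on (Suc (Suc 0)) S f"
  shows "frechet_derivative (\<lambda>y. frechet_derivative f (at y) u) (at x) v
       = frechet_derivative (\<lambda>y. frechet_derivative f (at y) v) (at x) u"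
proof (rule euclidean_eqI)
  fix i :: 'b
  have d1: "frechet_derivative (\<lambda>y. f y \<bullet> i) (at y) w = frechet_derivative f (at y) w \<bullet> i"
    if "y \<in> S" for y w
    using has_derivative_inner_left[OF Ck_on_has_derivative[OF assms(3) that], of i]
    by (metis frechet_derivative_at)
  have d2: "frechet_derivative (\<lambda>y. frechet_derivative (\<lambda>y. f y \<bullet> i) (at y) w) (at x) w'
      = frechet_derivative (\<lambda>y. frechet_derivative f (at y) w) (at x) w' \<bullet> i" for w w'
  proof -
    have "((\<lambda>y. frechet_derivative f (at y) w) has_derivative
        frechet_derivative (\<lambda>y. frechet_derivative f (at y) w) (at x)) (at x)"
      using assms by (intro Ck_on_has_derivative[of 0 S]) auto
    then have "((\<lambda>y. frechet_derivative (\<lambda>y. f y \<bullet> i) (at y) w) has_derivative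
        (\<lambda>w'. frechet_derivative (\<lambda>y. frechet_derivative f (at y) w) (at x) w' \<bullet> i)) (at x)"
      using assms(1,2) d1
      by (auto intro!: has_derivative_transform_within_open[OF has_derivative_inner_left])
    then show ?thesis
      by (metis frechet_derivative_at)
  qed
  have "Ck_on (Suc (Suc 0)) S (\<lambda>y. f y \<bullet> i)"
    by (rule Ck_on_bounded_linear[OF assms(1) bounded_linear_inner_left assms(3)])
  from symmetric_second_derivative_real[OF assms(1,2) this, of u v]
  show "frechet_derivative (\<lambda>y. frechet_derivative f (at y) u) (at x) v \<bullet> i
      = frechet_derivative (\<lambda>y. frechet_derivative f (at y) v) (at x) u \<bullet> i"
    by (simp only: d2)
qed

text \<open>Continuous coordinates of a differentiable map are differentiable: if \<open>T\<close> is a linear left inverse of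
  \<open>\<psi>'\<close>, then up to \<open>o(\<bar>\<phi> y - \<phi> z\<bar>)\<close> the difference \<open>\<phi> y - \<phi> z\<close> equals \<open>T (G y - G z)\<close>. The error is absorbed into
  the left-hand side, which bounds \<open>\<phi> y - \<phi> z\<close> linearly in \<open>y - z\<close>.\<close>

lemma differentiable_of_immersion_comp:
  fixes \<psi> :: "'b::euclidean_space \<Rightarrow> 'c::euclidean_space"
    and \<phi> :: "'a::real_normed_vector \<Rightarrow> 'b"
  assumes cont: "continuous (at z) \<phi>"
    and \<psi>': "(\<psi> has_derivative \<psi>') (at (\<phi> z))" and "inj \<psi>'"
    and G': "(G has_derivative G') (at z)"
    and S: "open S" "z \<in> S" "\<And>y. y \<in> S \<Longrightarrow> \<psi> (\<phi> y) = G y"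
  shows "\<phi> differentiable (at z)"
proof -
  obtain T where T: "linear T" "T \<circ> \<psi>' = id"
    using linear_injective_left_inverse[OF has_derivative_linear[OF \<psi>'] \<open>inj \<psi>'\<close>] by blast
  obtain B where "0 < B" and B: "\<And>x. norm (T x) \<le> B * norm x"
    using linear_bounded_pos[OF T(1)] by blast
  obtain C where "0 < C" and C: "\<And>h. norm (G' h) \<le> C * norm h"
    using bounded_linear.pos_bounded[OF has_derivative_bounded_linear[OF G']]
    by (metis mult.commute)
  have "(\<phi> has_derivative T \<circ> G') (at z)"
    unfolding has_derivative_at_alt
  proof (intro conjI allI impI)
    show "bounded_linear (T \<circ> G')"
      using bounded_linear_compose[OF linear_conv_bounded_linear[THEN iffD1, OF T(1)]
          has_derivative_bounded_linear[OF G']] by (simp add: comp_def)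
    fix e :: real assume "0 < e"
    \<comment> \<open>The second bounds make each of the two error terms at most \<open>e / 2 * norm (y - z)\<close>; the bound
      \<open>1 / (2 * B)\<close> lets \<open>B * (e2 * k)\<close> be absorbed into \<open>k\<close> below.\<close>
    define e1 where "e1 = min 1 (e / (2 * B))"
    define e2 where "e2 = min (1 / (2 * B)) (e / (4 * B * B * (C + 1)))"
    have "0 < e1" "0 < e2"
      using \<open>0 < e\<close> \<open>0 < B\<close> \<open>0 < C\<close> by (simp_all add: e1_def e2_def)
    obtain d1 where "0 < d1" and
      d1: "\<And>y. norm (y - z) < d1 \<Longrightarrow> norm (G y - G z - G' (y - z)) \<le> e1 * norm (y - z)"
      using G' \<open>0 < e1\<close> unfolding has_derivative_at_alt by blast
    obtain d2 where "0 < d2" and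
      d2: "\<And>y. norm (y - \<phi> z) < d2 \<Longrightarrow> norm (\<psi> y - \<psi> (\<phi> z) - \<psi>' (y - \<phi> z)) \<le> e2 * norm (y - \<phi> z)"
      using \<psi>' \<open>0 < e2\<close> unfolding has_derivative_at_alt by blast
    obtain d3 where "0 < d3" and d3: "\<And>y. norm (y - z) < d3 \<Longrightarrow> norm (\<phi> y - \<phi> z) < d2"
      using cont \<open>0 < d2\<close> unfolding continuous_at_eps_delta dist_norm by metis
    obtain d4 where "0 < d4" and d4: "\<And>y. norm (y - z) < d4 \<Longrightarrow> y \<in> S"
      using S(1,2) unfolding open_dist dist_norm by blast
    have "norm (\<phi> y - \<phi> z - (T \<circ> G') (y - z)) \<le> e * norm (y - z)"
      if y: "norm (y - z) < min (min d1 d3) d4" for y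
    proof -
      define h where "h = norm (y - z)"
      define k where "k = norm (\<phi> y - \<phi> z)"
      define r1 where "r1 = G y - G z - G' (y - z)"
      define r2 where "r2 = \<psi> (\<phi> y) - \<psi> (\<phi> z) - \<psi>' (\<phi> y - \<phi> z)"
      have r1: "norm r1 \<le> e1 * h"
        using d1 y by (simp add: r1_def h_def)
      have r2: "norm r2 \<le> e2 * k"
        using d2 d3 y by (simp add: r2_def k_def)
      have "\<psi>' (\<phi> y - \<phi> z) = G' (y - z) + r1 - r2"
        using S(2,3) d4[of y] y by (simp add: r1_def r2_def)
      then have "T (\<psi>' (\<phi> y - \<phi> z)) = T (G' (y - z)) + T r1 - T r2"
        by (simp add: linear_add[OF T(1)] linear_diff[OF T(1)])
      then have eq: "\<phi> y - \<phi> z = T (G' (y - z)) + T r1 - T r2"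
        using fun_cong[OF T(2), of "\<phi> y - \<phi> z"] by simp
      have b1: "norm (T r1) \<le> B * (e1 * h)"
        using \<open>0 < B\<close> by (intro order_trans[OF B mult_left_mono[OF r1]]) simp
      have b2: "norm (T r2) \<le> B * (e2 * k)"
        using \<open>0 < B\<close> by (intro order_trans[OF B mult_left_mono[OF r2]]) simp
      have b3: "norm (T (G' (y - z))) \<le> B * (C * h)"
        using \<open>0 < B\<close> unfolding h_def by (intro order_trans[OF B mult_left_mono[OF C]]) simp
      have "0 \<le> h" "0 \<le> k"
        by (simp_all add: h_def k_def)
      have e1: "e1 \<le> 1" "B * e1 \<le> e / 2"
        using \<open>0 < B\<close> by (simp_all add: e1_def min_def field_simps)
      have e2: "B * e2 \<le> 1 / 2" "B * e2 * (2 * B * (C + 1)) \<le> e / 2"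
      proof -
        have "B * e2 \<le> B * (1 / (2 * B))"
          using \<open>0 < B\<close> by (intro mult_left_mono) (simp_all add: e2_def)
        then show "B * e2 \<le> 1 / 2"
          using \<open>0 < B\<close> by simp
        have "e2 * (4 * B * B * (C + 1)) \<le> e / (4 * B * B * (C + 1)) * (4 * B * B * (C + 1))"
          using \<open>0 < B\<close> \<open>0 < C\<close> by (intro mult_right_mono) (simp_all add: e2_def)
        also have "\<dots> = e"
          using \<open>0 < B\<close> \<open>0 < C\<close> by simp
        finally show "B * e2 * (2 * B * (C + 1)) \<le> e / 2"
          by (simp add: algebra_simps)
      qed
      have "k \<le> norm (T (G' (y - z))) + norm (T r1) + norm (T r2)"
        unfolding k_def eq by (meson norm_triangle_ineq norm_triangle_ineq4 add_mono order_refl order_trans)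
      also have "\<dots> \<le> B * (C * h) + B * (e1 * h) + B * (e2 * k)"
        using b1 b2 b3 by simp
      also have "B * (e1 * h) \<le> B * (1 * h)"
        using \<open>0 < B\<close> \<open>0 \<le> h\<close> e1(1) by (intro mult_left_mono mult_right_mono) auto
      also have "B * (e2 * k) \<le> 1 / 2 * k"
        using mult_right_mono[OF e2(1) \<open>0 \<le> k\<close>] by (simp add: mult.assoc)
      finally have "k \<le> 2 * B * (C + 1) * h"
        by (simp add: algebra_simps)
      then have "B * e2 * k \<le> B * e2 * (2 * B * (C + 1) * h)"
        using \<open>0 < B\<close> \<open>0 < e2\<close> by (intro mult_left_mono) auto
      also have "\<dots> = B * e2 * (2 * B * (C + 1)) * h"
        by simp
      also have "\<dots> \<le> e / 2 * h"
        using e2(2) \<open>0 \<le> h\<close> by (rule mult_right_mono)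
      finally have "B * (e2 * k) \<le> e / 2 * h"
        by (simp add: mult.assoc)
      moreover have "B * (e1 * h) \<le> e / 2 * h"
        using mult_right_mono[OF e1(2) \<open>0 \<le> h\<close>] by (simp add: mult.assoc)
      ultimately have "norm (T r1) + norm (T r2) \<le> e * h"
        using b1 b2 by (simp add: field_simps)
      moreover have "norm (\<phi> y - \<phi> z - (T \<circ> G') (y - z)) \<le> norm (T r1) + norm (T r2)"
      proof -
        have "\<phi> y - \<phi> z - (T \<circ> G') (y - z) = T r1 - T r2"
          using eq by simp
        then show ?thesis
          by (simp only: norm_triangle_ineq4)
      qed
      ultimately show ?thesis
        by (simp add: h_def)
    qed
    then show "\<exists>d>0. \<forall>y. norm (y - z) < d \<longrightarrow>
        norm (\<phi> y - \<phi> z - (T \<circ> G') (y - z)) \<le> e * norm (y - z)"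
      using \<open>0 < d1\<close> \<open>0 < d3\<close> \<open>0 < d4\<close> by (intro exI[of _ "min (min d1 d3) d4"]) simp
  qed
  then show ?thesis
    by (rule differentiableI)
qed


section \<open>Endomorphisms of a plane\<close>

lemma linear_factors_through_plane_basis:
  fixes E R :: "real^2 \<Rightarrow> 'a::real_vector"
  assumes "linear E" "inj E" "linear R" "range R \<subseteq> range E"
  obtains Q :: "real^2^2" where "\<And>w. R w = E (Q *v w)"
proof -
  obtain E' where E': "linear E'" "E' \<circ> E = id"
    using linear_injective_left_inverse[OF assms(1,2)] by blast
  define Q where "Q = matrix (E' \<circ> R)"
  have "Q *v w = E' (R w)" for w
    unfolding Q_def using linear_compose[OF assms(3) E'(1)] by (simp add: matrix_works)
  moreover have "E (E' (R w)) = R w" for w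
  proof -
    obtain v where "R w = E v" using assms(4) by blast
    then show ?thesis using fun_cong[OF E'(2), of v] by simp
  qed
  ultimately have "R w = E (Q *v w)" for w by simp
  then show thesis by (rule that)
qed

text \<open>The matrices of one endomorphism in two bases are conjugate, so the basis chosen in \<open>matrix_on\<close> is
  immaterial.\<close>

lemma det_on_eq_and_trace_on_eq:
  fixes E :: "real^2 \<Rightarrow> 'a::real_vector"
  assumes "linear E" "inj E" "range E = P" "\<And>w. L (E w) = E (Q *v w)"
  shows "det_on P L = det Q" "trace_on P L = trace Q"
proof -
  define Q' where "Q' = matrix_on P L"
  have "\<exists>E :: real^2 \<Rightarrow> 'a. linear E \<and> inj E \<and> range E = P \<and> (\<forall>w. L (E w) = E (Q' *v w))"
    unfolding Q'_def matrix_on_def by (rule someI[where x = Q]) (use assms in blast)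
  then obtain E' :: "real^2 \<Rightarrow> 'a" where E': "linear E'" "inj E'" "range E' = P"
    "\<And>w. L (E' w) = E' (Q' *v w)" by blast
  obtain R where R: "\<And>w. E' w = E (R *v w)"
    using linear_factors_through_plane_basis[OF assms(1,2) E'(1)] assms(3) E'(3) by blast
  obtain R' where R': "\<And>w. E w = E' (R' *v w)"
    using linear_factors_through_plane_basis[OF E'(1,2) assms(1)] assms(3) E'(3) by blast
  have "E (R *v (R' *v w)) = E w" for w
    using R R' by simp
  then have "(R ** R') *v w = w" for w
    using injD[OF assms(2)] by (metis matrix_vector_mul_assoc)
  then have RR': "R ** R' = mat 1"
    by (simp add: matrix_eq)
  have "E ((R ** Q') *v w) = E ((Q ** R) *v w)" for w
    by (metis R E'(4) assms(4) matrix_vector_mul_assoc)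
  then have "R ** Q' = Q ** R"
    using injD[OF assms(2)] by (metis matrix_eq)
  moreover have "R' ** R = mat 1"
    using RR' by (simp add: matrix_left_right_inverse)
  ultimately have "Q' = R' ** (Q ** R)"
    by (metis matrix_mul_assoc matrix_mul_lid)
  then have "det Q' = det Q * (det R * det R')" "trace Q' = trace (Q ** (R ** R'))"
    using trace_mul_sym[of R' "Q ** R"] by (simp_all add: det_mul matrix_mul_assoc)
  moreover have "det R * det R' = 1"
    using RR' by (metis det_I det_mul)
  ultimately show "det_on P L = det Q" "trace_on P L = trace Q"
    using RR' by (simp_all add: det_on_def trace_on_def Q'_def)
qed

lemma cayley_hamilton_2:
  fixes Q :: "real^2^2"
  shows "Q *v (Q *v w) = trace Q *\<^sub>R (Q *v w) - det Q *\<^sub>R w"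
  by (simp add: vec_eq_iff forall_2 matrix_vector_mult_def sum_2 trace_def det_2 algebra_simps)

text \<open>The algebraic core. Self-adjointness and nondegeneracy turn the condition on \<open>b\<close> into \<open>Q\<^sup>2 = c I\<close>.
  Comparing with Cayley-Hamilton, a non-zero trace would make \<open>Q\<close> scalar, which a
  negative determinant excludes.\<close>

lemma self_adjoint_conformal_iff:
  fixes Q :: "real^2^2" and b :: "real^2 \<Rightarrow> real^2 \<Rightarrow> real"
  assumes b: "bilinear b"
    and nondegenerate: "\<And>y. (\<And>x. b x y = 0) \<Longrightarrow> y = 0"
    and adj: "\<And>x y. b (Q *v x) y = b x (Q *v y)"
    and neg: "det Q < 0"
  shows "(\<forall>x y. b (Q *v x) (Q *v y) = c * b x y) \<longleftrightarrow> trace Q = 0 \<and> c = - det Q"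
proof
  assume c: "\<forall>x y. b (Q *v x) (Q *v y) = c * b x y"
  have lin: "linear (b x)" for x
    using b by (simp add: bilinear_def)
  have sq: "Q *v (Q *v y) = c *\<^sub>R y" for y
  proof -
    have "b x (Q *v (Q *v y) - c *\<^sub>R y) = 0" for x
      using c adj[of x "Q *v y"] by (simp add: linear_diff[OF lin] linear_scale[OF lin])
    then show ?thesis
      using nondegenerate by fastforce
  qed
  have scalar: "trace Q *\<^sub>R (Q *v y) = (c + det Q) *\<^sub>R y" for y
    using cayley_hamilton_2[of Q y] sq[of y] by (simp add: algebra_simps)
  have tr: "trace Q = 0"
  proof (rule ccontr)
    assume t: "trace Q \<noteq> 0"
    define k where "k = (c + det Q) / trace Q"
    have "Q *v y = k *\<^sub>R y" for y
    proof -
      have "Q *v y = (1 / trace Q) *\<^sub>R (trace Q *\<^sub>R (Q *v y))"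
        using t by simp
      also have "\<dots> = k *\<^sub>R y"
        unfolding scalar k_def by simp
      finally show ?thesis .
    qed
    then have "Q = k *\<^sub>R mat 1"
      by (simp add: matrix_eq scaleR_matrix_vector_assoc[symmetric])
    then have "det Q = k * k"
      by (simp add: det_2 mat_def)
    then show False
      using neg by (simp add: not_less[symmetric])
  qed
  have "(c + det Q) *\<^sub>R (axis 1 1 :: real^2) = 0"
    using scalar[of "axis 1 1"] tr by simp
  then show "trace Q = 0 \<and> c = - det Q"
    using tr by (simp add: axis_eq_0_iff)
next
  assume c: "trace Q = 0 \<and> c = - det Q"
  have lin: "linear (b x)" for x
    using b by (simp add: bilinear_def)
  have "b (Q *v x) (Q *v y) = b x (Q *v (Q *v y))" for x y
    by (simp add: adj)
  with c show "\<forall>x y. b (Q *v x) (Q *v y) = c * b x y"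
    by (simp add: cayley_hamilton_2 linear_neg[OF lin] linear_scale[OF lin])
qed

lemma range_eq_orthogonal_complement:
  fixes E :: "real^2 \<Rightarrow> real^3"
  assumes "linear E" "inj E" "n \<noteq> 0" "\<And>w. n \<bullet> E w = 0"
  shows "range E = {v. n \<bullet> v = 0}"
  using assms
  by (intro subspace_dim_equal linear_subspace_image subspace_UNIV subspace_hyperplane)
    (auto simp: dim_image_eq dim_hyperplane)


section \<open>Tangent planes, differentials and the affine form in charts\<close>

lemma chart_inv_into:
  assumes "smooth_atlas M A" "(U, x) \<in> A" "p \<in> U"
  shows "inv_into U x (x p) = p"
proof -
  have "homeomorphism U (x ` U) x (inv_into U x)"
    using assms by (auto simp: smooth_atlas_def)
  then show ?thesis
    using assms(3) by (simp add: homeomorphism_def)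
qed

lemma chart_domain_subset: "smooth_atlas M A \<Longrightarrow> (U, x) \<in> A \<Longrightarrow> U \<subseteq> M"
  by (auto simp: smooth_atlas_def)

lemma chart_domain_openin: "smooth_atlas M A \<Longrightarrow> (U, x) \<in> A \<Longrightarrow> openin (top_of_set M) U"
  by (auto simp: smooth_atlas_def)

lemma open_chart_range: "smooth_atlas M A \<Longrightarrow> (U, x) \<in> A \<Longrightarrow> open (x ` U)"
  by (auto simp: smooth_atlas_def)

lemma open_chart_image:
  assumes "smooth_atlas M A" "(U, x) \<in> A" "openin (top_of_set M) W"
  shows "open (x ` (U \<inter> W))"
proof -
  have U: "U \<subseteq> M" "open (x ` U)" "homeomorphism U (x ` U) x (inv_into U x)"
    using assms(1,2) by (auto simp: smooth_atlas_def)
  obtain T where "open T" "W = M \<inter> T"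
    using assms(3) by (auto simp: openin_open)
  then have "openin (top_of_set U) (U \<inter> W)"
    using U(1) by (auto simp: openin_open)
  then have "openin (top_of_set (x ` U)) (x ` (U \<inter> W))"
    by (rule homeomorphism_imp_open_map[OF U(3)])
  then show ?thesis
    using U(2) openin_open_trans by blast
qed

lemma smooth_map_chart:
  assumes "smooth_map A W g" "(U, x) \<in> A"
  shows "Ck_on k (x ` (U \<inter> W)) (g \<circ> inv_into U x)"
  using bspec[OF assms(1)[unfolded smooth_map_def] assms(2)] by (simp add: smooth_on_def)

lemma smooth_transition:
  assumes "smooth_atlas M A" "(U, x) \<in> A" "(V, y) \<in> A"
  shows "Ck_on k (x ` (U \<inter> V)) (y \<circ> inv_into U x)"
proof -
  have "\<forall>(U, x)\<in>A. \<forall>(V, y)\<in>A. smooth_on (x ` (U \<inter> V)) (y \<circ> inv_into U x)"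
    using assms(1) by (simp add: smooth_atlas_def)
  from bspec[OF this assms(2)]
  have "\<forall>(V, y)\<in>A. smooth_on (x ` (U \<inter> V)) (y \<circ> inv_into U x)"
    by simp
  from bspec[OF this assms(3)] show ?thesis
    by (simp add: smooth_on_def)
qed

lemma smooth_map_chart_has_derivative:
  assumes "smooth_atlas M A" "smooth_map A W g" "(U, x) \<in> A" "p \<in> U" "p \<in> W"
  shows "(g \<circ> inv_into U x has_derivative chart_deriv (U, x) g p) (at (x p))"
  unfolding chart_deriv_def fst_conv snd_conv
  by (rule Ck_on_has_derivative[OF smooth_map_chart[OF assms(2,3), of "Suc 0"]]) (use assms(4,5) in blast)

lemma chart_transition_has_derivative:
  assumes "smooth_atlas M A" "(U, x) \<in> A" "(V, y) \<in> A" "p \<in> U" "p \<in> V"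
  shows "(y \<circ> inv_into U x has_derivative frechet_derivative (y \<circ> inv_into U x) (at (x p))) (at (x p))"
  by (rule Ck_on_has_derivative[OF smooth_transition[OF assms(1-3), of "Suc 0"]]) (use assms(4,5) in blast)

text \<open>The chain rule for a change of chart. The transition derivative is the same for all \<open>g\<close>, which
  makes \<open>tangent_plane\<close> and \<open>differential\<close> independent of the chart.\<close>

lemma chart_deriv_transition:
  assumes A: "smooth_atlas M A" and g: "smooth_map A W g"
    and U: "(U, x) \<in> A" "p \<in> U" and V: "(V, y) \<in> A" "p \<in> V" and "p \<in> W"
  shows "chart_deriv (U, x) g p =
    chart_deriv (V, y) g p \<circ> frechet_derivative (y \<circ> inv_into U x) (at (x p))"
    (is "_ = _ \<circ> ?\<tau>")
proof -
  have "(g \<circ> inv_into V y has_derivative chart_deriv (V, y) g p) (at ((y \<circ> inv_into U x) (x p)))"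
    using smooth_map_chart_has_derivative[OF A g V \<open>p \<in> W\<close>] chart_inv_into[OF A U] by simp
  from diff_chain_at[OF chart_transition_has_derivative[OF A U(1) V(1) U(2) V(2)] this]
  have "(g \<circ> inv_into V y \<circ> (y \<circ> inv_into U x) has_derivative chart_deriv (V, y) g p \<circ> ?\<tau>) (at (x p))" .
  then have "(g \<circ> inv_into U x has_derivative chart_deriv (V, y) g p \<circ> ?\<tau>) (at (x p))"
  proof (rule has_derivative_transform_within_open)
    show "open (x ` (U \<inter> V))"
      using open_chart_image[OF A U(1) chart_domain_openin[OF A V(1)]] .
    fix z assume "z \<in> x ` (U \<inter> V)"
    then show "(g \<circ> inv_into V y \<circ> (y \<circ> inv_into U x)) z = (g \<circ> inv_into U x) z"
      using chart_inv_into[OF A U(1)] chart_inv_into[OF A V(1)] by auto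
  qed (use U V in auto)
  then show ?thesis
    unfolding chart_deriv_def[of "(U, x)"] fst_conv snd_conv by (rule frechet_derivative_at[symmetric])
qed

lemma immersed_surface_atlas: "immersed_surface M A f \<Longrightarrow> smooth_atlas M A"
  and immersed_surface_smooth: "immersed_surface M A f \<Longrightarrow> smooth_map A M f"
  and immersed_surface_inj:
    "immersed_surface M A f \<Longrightarrow> (U, x) \<in> A \<Longrightarrow> p \<in> U \<Longrightarrow> inj (chart_deriv (U, x) f p)"
  by (auto simp: immersed_surface_def)

lemma immersed_surface_chart_has_derivative:
  assumes "immersed_surface M A f" "(U, x) \<in> A" "p \<in> U"
  shows "(f \<circ> inv_into U x has_derivative chart_deriv (U, x) f p) (at (x p))"
  using smooth_map_chart_has_derivative[OF immersed_surface_atlas[OF assms(1)]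
      immersed_surface_smooth[OF assms(1)] assms(2,3)]
    chart_domain_subset[OF immersed_surface_atlas[OF assms(1)] assms(2)] assms(3) by blast

lemma tangent_plane_eq_range:
  assumes f: "immersed_surface M A f" and U: "(U, x) \<in> A" "p \<in> U"
  shows "tangent_plane A f p = range (chart_deriv (U, x) f p)"
proof -
  note A = immersed_surface_atlas[OF f]
  have "p \<in> M"
    using chart_domain_subset[OF A] U by blast
  have "range (chart_deriv (V, y) f p) \<subseteq> range (chart_deriv (U, x) f p)"
    if "(V, y) \<in> A" "p \<in> V" for V y
    unfolding chart_deriv_transition[OF A immersed_surface_smooth[OF f] that U \<open>p \<in> M\<close>] by auto
  then show ?thesis
    using U unfolding tangent_plane_def by fastforce
qed

text \<open>Two representations of a tangent vector in two charts differ by the transition derivative, because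
  the differential of the immersion is injective; so the description in \<open>differential\<close> is unique.\<close>

lemma differential_chart:
  assumes f: "immersed_surface M A f" and g: "smooth_map A W g" "p \<in> W"
    and U: "(U, x) \<in> A" "p \<in> U"
  shows "differential A f g p (chart_deriv (U, x) f p w) = chart_deriv (U, x) g p w"
  unfolding differential_def
proof (rule the_equality)
  show "\<exists>C\<in>A. p \<in> fst C \<and> (\<exists>w'. chart_deriv C f p w' = chart_deriv (U, x) f p w \<and>
      chart_deriv C g p w' = chart_deriv (U, x) g p w)"
    using U by force
next
  fix u
  assume "\<exists>C\<in>A. p \<in> fst C \<and> (\<exists>w'. chart_deriv C f p w' = chart_deriv (U, x) f p w \<and>
      chart_deriv C g p w' = u)"
  then obtain V y w' where V: "(V, y) \<in> A" "p \<in> V"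
    and w': "chart_deriv (V, y) f p w' = chart_deriv (U, x) f p w" "chart_deriv (V, y) g p w' = u"
    by auto
  note A = immersed_surface_atlas[OF f]
  have "p \<in> M"
    using chart_domain_subset[OF A] U by blast
  let ?\<tau> = "frechet_derivative (x \<circ> inv_into V y) (at (y p))"
  have "chart_deriv (U, x) f p (?\<tau> w') = chart_deriv (U, x) f p w"
    using w'(1) chart_deriv_transition[OF A immersed_surface_smooth[OF f] V U \<open>p \<in> M\<close>] by simp
  then have "?\<tau> w' = w"
    using immersed_surface_inj[OF f U] by (simp add: inj_eq)
  then show "u = chart_deriv (U, x) g p w"
    using w'(2) chart_deriv_transition[OF A g(1) V U g(2)] by simp
qed

text \<open>Every tangent vector extends to a tangent field. Without such an extension the condition that defines
  \<open>affine_form\<close> would hold for every number. Smoothness has to be checked in all charts, hence the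
  composition with a transition map.\<close>

lemma tangent_field_on_coordinate:
  assumes f: "immersed_surface M A f" and U: "(U, x) \<in> A"
  shows "tangent_field_on A f U (\<lambda>q. chart_deriv (U, x) f q w)"
  unfolding tangent_field_on_def
proof
  note A = immersed_surface_atlas[OF f]
  let ?Z = "\<lambda>q. chart_deriv (U, x) f q w"
  let ?f = "f \<circ> inv_into U x"
  have "U \<inter> M = U"
    using chart_domain_subset[OF A U] by blast
  then have "Ck_on (Suc k) (x ` U) ?f" for k
    using smooth_map_chart[OF immersed_surface_smooth[OF f] U, of "Suc k"] by simp
  then have f': "Ck_on k (x ` U) (\<lambda>z. frechet_derivative ?f (at z) w)" for k
    by simp
  have "smooth_on (y ` (V \<inter> U)) (?Z \<circ> inv_into V y)" if V: "(V, y) \<in> A" for V y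
    unfolding smooth_on_def
  proof
    fix k
    have op: "open (y ` (V \<inter> U))" "open (x ` U)"
      using open_chart_image[OF A V chart_domain_openin[OF A U]] A U by (auto simp: smooth_atlas_def)
    have inv: "inv_into V y z \<in> V \<inter> U" if "z \<in> y ` (V \<inter> U)" for z
      using that chart_inv_into[OF A V] by auto
    have "Ck_on k (y ` (V \<inter> U)) (x \<circ> inv_into V y)"
      by (rule smooth_transition[OF A V U])
    from Ck_on_compose[OF op _ this f'] inv
    have "Ck_on k (y ` (V \<inter> U)) ((\<lambda>z. frechet_derivative ?f (at z) w) \<circ> (x \<circ> inv_into V y))"
      by auto
    then show "Ck_on k (y ` (V \<inter> U)) (?Z \<circ> inv_into V y)"
      by (simp add: chart_deriv_def comp_def)
  qed
  then show "smooth_map A U ?Z"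
    by (auto simp: smooth_map_def)
  show "\<forall>q\<in>U. ?Z q \<in> tangent_plane A f q"
    using tangent_plane_eq_range[OF f U] by blast
qed

lemma orthogonal_derivative:
  fixes Z \<Xi> :: "'a::real_normed_vector \<Rightarrow> 'b::real_inner"
  assumes "(Z has_derivative Z') (at z)" "(\<Xi> has_derivative \<Xi>') (at z)"
    and "open S" "z \<in> S" "\<And>y. y \<in> S \<Longrightarrow> Z y \<bullet> \<Xi> y = c"
  shows "Z' v \<bullet> \<Xi> z = - (Z z \<bullet> \<Xi>' v)"
proof -
  have "((\<lambda>y. Z y \<bullet> \<Xi> y) has_derivative (\<lambda>v. Z z \<bullet> \<Xi>' v + Z' v \<bullet> \<Xi> z)) (at z)"
    using assms(1,2) by (rule has_derivative_inner)
  moreover have "((\<lambda>y. Z y \<bullet> \<Xi> y) has_derivative (\<lambda>v. 0)) (at z)"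
    by (rule has_derivative_transform_within_open[OF has_derivative_const assms(3,4)])
      (use assms(5) in auto)
  ultimately have "(\<lambda>v. Z z \<bullet> \<Xi>' v + Z' v \<bullet> \<Xi> z) = (\<lambda>v. 0)"
    by (rule has_derivative_unique)
  then show ?thesis
    by (metis add.commute eq_neg_iff_add_eq_0)
qed

text \<open>Since \<open>\<langle>Z, \<xi>\<rangle> = 0\<close> for a tangent field \<open>Z\<close>, one has \<open>\<langle>D\<^sub>X Z, \<xi>\<rangle> = -\<langle>Z, D\<^sub>X \<xi>\<rangle>\<close>, which depends only on \<open>Z(p)\<close>.
  Dividing by \<open>\<langle>\<eta>, \<xi>\<rangle>\<close> gives the transversal coefficient of the Gauss formula.\<close>

lemma affine_form_chart:
  assumes f: "immersed_surface M A f" and U: "(U, x) \<in> A" "p \<in> U"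
    and \<xi>': "(\<xi> \<circ> inv_into U x has_derivative \<Xi>') (at (x p))"
    and normal: "\<And>q v. q \<in> M \<Longrightarrow> v \<in> tangent_plane A f q \<Longrightarrow> v \<bullet> \<xi> q = 0"
    and transversal: "\<eta> p \<bullet> \<xi> p \<noteq> 0"
  shows "affine_form M A f \<eta> p (chart_deriv (U, x) f p v) (chart_deriv (U, x) f p w) =
    - (chart_deriv (U, x) f p w \<bullet> \<Xi>' v) / (\<eta> p \<bullet> \<xi> p)"
proof -
  note A = immersed_surface_atlas[OF f]
  let ?X = "chart_deriv (U, x) f p v" and ?Y = "chart_deriv (U, x) f p w"
  have "U \<subseteq> M" "p \<in> M"
    using chart_domain_subset[OF A U(1)] U by auto
  have plane: "tangent_plane A f p = {v. \<xi> p \<bullet> v = 0}"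
    unfolding tangent_plane_eq_range[OF f U]
  proof (rule range_eq_orthogonal_complement)
    show "linear (chart_deriv (U, x) f p)"
      using has_derivative_linear immersed_surface_chart_has_derivative[OF f U] by blast
    show "inj (chart_deriv (U, x) f p)"
      by (rule immersed_surface_inj[OF f U])
    show "\<xi> p \<noteq> 0"
      using transversal by auto
    show "\<xi> p \<bullet> chart_deriv (U, x) f p w = 0" for w
      using normal[OF \<open>p \<in> M\<close>, of "chart_deriv (U, x) f p w"] tangent_plane_eq_range[OF f U]
      by (simp add: inner_commute)
  qed
  have D: "differential A f Z p ?X \<bullet> \<xi> p = - (?Y \<bullet> \<Xi>' v)"
    if W: "openin (top_of_set M) W" "p \<in> W" and Z: "tangent_field_on A f W Z" "Z p = ?Y" for W Z
  proof -
    have sm: "smooth_map A W Z" and tan: "\<And>q. q \<in> W \<Longrightarrow> Z q \<in> tangent_plane A f q"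
      using Z(1) by (auto simp: tangent_field_on_def)
    have "chart_deriv (U, x) Z p v \<bullet> (\<xi> \<circ> inv_into U x) (x p) = - ((Z \<circ> inv_into U x) (x p) \<bullet> \<Xi>' v)"
    proof (rule orthogonal_derivative[where c = 0 and Z' = "chart_deriv (U, x) Z p" and \<Xi>' = \<Xi>'
          and Z = "Z \<circ> inv_into U x" and \<Xi> = "\<xi> \<circ> inv_into U x" and S = "x ` (U \<inter> W)"])
      show "(Z \<circ> inv_into U x has_derivative chart_deriv (U, x) Z p) (at (x p))"
        using smooth_map_chart_has_derivative[OF A sm U W(2)] .
      show "open (x ` (U \<inter> W))"
        by (rule open_chart_image[OF A U(1) W(1)])
      fix z assume "z \<in> x ` (U \<inter> W)"
      then show "(Z \<circ> inv_into U x) z \<bullet> (\<xi> \<circ> inv_into U x) z = 0"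
        using chart_inv_into[OF A U(1)] tan normal \<open>U \<subseteq> M\<close> by auto
    qed (use \<xi>' U W in auto)
    then show ?thesis
      using differential_chart[OF f sm W(2) U] chart_inv_into[OF A U] Z(2) by simp
  qed
  show ?thesis
    unfolding affine_form_def
  proof (rule the_equality)
    show "\<forall>W Z. openin (top_of_set M) W \<and> p \<in> W \<and> tangent_field_on A f W Z \<and> Z p = ?Y \<longrightarrow>
        differential A f Z p ?X - (- (?Y \<bullet> \<Xi>' v) / (\<eta> p \<bullet> \<xi> p)) *\<^sub>R \<eta> p \<in> tangent_plane A f p"
    proof (intro allI impI, elim conjE)
      fix W Z
      assume "openin (top_of_set M) W" "p \<in> W" "tangent_field_on A f W Z" "Z p = ?Y"
      from D[OF this]
      show "differential A f Z p ?X - (- (?Y \<bullet> \<Xi>' v) / (\<eta> p \<bullet> \<xi> p)) *\<^sub>R \<eta> p \<in> tangent_plane A f p"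
        using transversal by (simp add: plane inner_commute[of "\<xi> p"] inner_add_left)
    qed
  next
    fix a
    let ?Z = "\<lambda>q. chart_deriv (U, x) f q w"
    assume "\<forall>W Z. openin (top_of_set M) W \<and> p \<in> W \<and> tangent_field_on A f W Z \<and> Z p = ?Y \<longrightarrow>
        differential A f Z p ?X - a *\<^sub>R \<eta> p \<in> tangent_plane A f p"
    then have "differential A f ?Z p ?X - a *\<^sub>R \<eta> p \<in> tangent_plane A f p"
      using chart_domain_openin[OF A U(1)] U(2) tangent_field_on_coordinate[OF f U(1)] by blast
    moreover have "differential A f ?Z p ?X \<bullet> \<xi> p = - (?Y \<bullet> \<Xi>' v)"
      by (rule D[OF chart_domain_openin[OF A U(1)] U(2) tangent_field_on_coordinate[OF f U(1)] refl])
    ultimately show "a = - (?Y \<bullet> \<Xi>' v) / (\<eta> p \<bullet> \<xi> p)"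
      using transversal by (simp add: plane inner_commute[of "\<xi> p"] inner_diff_left field_simps)
  qed
qed

lemma immersed_surface_chart_around:
  assumes "immersed_surface M A f" "p \<in> M"
  obtains U x where "(U, x) \<in> A" "p \<in> U"
  using immersed_surface_atlas[OF assms(1)] assms(2) unfolding smooth_atlas_def by blast

lemma linear_chart_deriv:
  "immersed_surface M A f \<Longrightarrow> (U, x) \<in> A \<Longrightarrow> p \<in> U \<Longrightarrow> linear (chart_deriv (U, x) f p)"
  by (rule has_derivative_linear[OF immersed_surface_chart_has_derivative])


section \<open>The Birkhoff-Gauss map and its shape operator\<close>

text \<open>The functional \<open>x \<mapsto> \<langle>\<nu>, x\<rangle> / \<langle>\<nu>, v\<rangle>\<close> has value \<open>1\<close> at \<open>v\<close> and vanishes on the plane. A vector of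
  value \<open>a \<noteq> 0\<close> is \<open>a\<close> times a vector \<open>v + w\<close> with \<open>w\<close> in the plane, and \<open>N (v + w) \<ge> 1\<close>.\<close>

lemma birkhoff_orthogonal_supports:
  fixes \<nu> :: "'a::real_inner"
  assumes N: "is_norm N" and "N v = 1" and orth: "birkhoff_orthogonal N v {w. \<nu> \<bullet> w = 0}"
  shows "\<nu> \<bullet> v \<noteq> 0" "\<nu> \<bullet> x / (\<nu> \<bullet> v) \<le> N x"
proof -
  have supp: "1 \<le> N (v + w)" if "\<nu> \<bullet> w = 0" for w
    using orth that \<open>N v = 1\<close> unfolding birkhoff_orthogonal_def
    by (metis mem_Collect_eq scaleR_one)
  show v: "\<nu> \<bullet> v \<noteq> 0"
  proof
    assume "\<nu> \<bullet> v = 0"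
    then have "1 \<le> N (v + (- v))"
      by (intro supp) simp
    moreover have "N 0 = 0"
      using N by (simp add: is_norm_def)
    ultimately show False
      by simp
  qed
  define a where "a = \<nu> \<bullet> x / (\<nu> \<bullet> v)"
  have "a \<le> N x"
  proof (cases "a = 0")
    case True
    then show ?thesis
      using N by (simp add: is_norm_def)
  next
    case False
    have "\<nu> \<bullet> ((1 / a) *\<^sub>R x - v) = 0"
      using v False by (simp add: inner_diff_right a_def)
    from supp[OF this] have "1 \<le> N ((1 / a) *\<^sub>R x)"
      by simp
    also have "\<dots> = N x / \<bar>a\<bar>"
      using N by (simp add: is_norm_def)
    finally show ?thesis
      using False by (simp add: field_simps)
  qed
  then show "\<nu> \<bullet> x / (\<nu> \<bullet> v) \<le> N x"
    by (simp add: a_def)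
qed

text \<open>The supporting functional is at most \<open>1\<close> on the unit sphere and attains \<open>1\<close> at \<open>G z\<close>, so its
  derivative along \<open>G\<close> vanishes at \<open>z\<close>. This is applied both to parametrizations of the unit sphere
  and to the Birkhoff-Gauss map.\<close>

lemma birkhoff_orthogonal_derivative:
  fixes \<nu> :: "'a::real_inner"
  assumes N: "is_norm N" and orth: "birkhoff_orthogonal N (G z) {w. \<nu> \<bullet> w = 0}"
    and G': "(G has_derivative G') (at z)"
    and S: "open S" "z \<in> S" "\<And>y. y \<in> S \<Longrightarrow> N (G y) = 1"
  shows "\<nu> \<bullet> G' h = 0"
proof -
  note supp = birkhoff_orthogonal_supports[OF N S(3)[OF S(2)] orth]
  have "((\<lambda>y. \<nu> \<bullet> G y / (\<nu> \<bullet> G z)) has_derivative (\<lambda>h. \<nu> \<bullet> G' h / (\<nu> \<bullet> G z))) (at z)"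
    using G' supp(1) by (auto intro!: derivative_eq_intros simp: divide_inverse)
  moreover have "\<forall>y\<in>S. \<nu> \<bullet> G y / (\<nu> \<bullet> G z) \<le> \<nu> \<bullet> G z / (\<nu> \<bullet> G z)"
    using supp S(3) by (metis divide_self)
  ultimately have "(\<lambda>h. \<nu> \<bullet> G' h / (\<nu> \<bullet> G z)) = (\<lambda>h. 0)"
    using differential_zero_maxmin[OF S(2,1)] by blast
  then show ?thesis
    using supp(1) by (metis divide_eq_0_iff)
qed

lemma plane_normal_exists:
  fixes E :: "real^2 \<Rightarrow> real^3"
  assumes "linear E" "inj E"
  obtains \<nu> where "\<nu> \<noteq> 0" "range E = {w. \<nu> \<bullet> w = 0}"
proof -
  have "dim (range E) < DIM(real^3)"
    using assms by (simp add: dim_image_eq)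
  then obtain \<nu> where "\<nu> \<noteq> 0" "\<And>w. w \<in> span (range E) \<Longrightarrow> orthogonal \<nu> w"
    using orthogonal_to_subspace_exists by blast
  then have "\<nu> \<bullet> E w = 0" for w
    by (simp add: orthogonal_def span_base)
  with range_eq_orthogonal_complement[OF assms \<open>\<nu> \<noteq> 0\<close>] \<open>\<nu> \<noteq> 0\<close> show thesis
    by (blast intro: that)
qed

text \<open>The normal of \<open>T\<^sub>q M\<close> annihilates the derivative of every parametrization of the sphere at \<open>\<eta>(q)\<close>,
  where \<open>T\<^sub>q M\<close> supports the ball; two planes with a common normal are equal.\<close>

lemma unit_sphere_tangent_plane_eq:
  assumes N: "is_norm N"
    and S: "immersed_surface (unit_sphere N) A' (\<lambda>x. x)"
    and f: "immersed_surface M A f"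
    and \<eta>: "birkhoff_gauss_map N M A f \<eta>" and "q \<in> M"
  shows "tangent_plane A' (\<lambda>x. x) (\<eta> q) = tangent_plane A f q"
proof -
  obtain U x where U: "(U, x) \<in> A" "q \<in> U"
    using immersed_surface_chart_around[OF f \<open>q \<in> M\<close>] .
  have \<eta>q: "\<eta> q \<in> unit_sphere N" "birkhoff_orthogonal N (\<eta> q) (tangent_plane A f q)"
    using \<eta> \<open>q \<in> M\<close> by (auto simp: birkhoff_gauss_map_def)
  obtain V y where V: "(V, y) \<in> A'" "\<eta> q \<in> V"
    using immersed_surface_chart_around[OF S \<eta>q(1)] .
  obtain \<nu> where "\<nu> \<noteq> 0" and \<nu>: "range (chart_deriv (U, x) f q) = {w. \<nu> \<bullet> w = 0}"
    using plane_normal_exists[OF linear_chart_deriv[OF f U] immersed_surface_inj[OF f U]] .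
  note A' = immersed_surface_atlas[OF S]
  let ?\<psi> = "(\<lambda>x. x) \<circ> inv_into V y"
  have "\<nu> \<bullet> chart_deriv (V, y) (\<lambda>x. x) (\<eta> q) h = 0" for h
  proof (rule birkhoff_orthogonal_derivative[OF N, where G = ?\<psi> and z = "y (\<eta> q)" and S = "y ` V"])
    show "birkhoff_orthogonal N (?\<psi> (y (\<eta> q))) {w. \<nu> \<bullet> w = 0}"
      using \<eta>q(2) chart_inv_into[OF A' V] by (simp add: tangent_plane_eq_range[OF f U] \<nu>)
    show "(?\<psi> has_derivative chart_deriv (V, y) (\<lambda>x. x) (\<eta> q)) (at (y (\<eta> q)))"
      by (rule immersed_surface_chart_has_derivative[OF S V])
    show "open (y ` V)"
      by (rule open_chart_range[OF A' V(1)])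
    show "y (\<eta> q) \<in> y ` V"
      using V(2) by simp
    show "N (?\<psi> z) = 1" if "z \<in> y ` V" for z
      using that chart_inv_into[OF A' V(1)] chart_domain_subset[OF A' V(1)]
      by (auto simp: unit_sphere_def)
  qed
  from range_eq_orthogonal_complement[OF linear_chart_deriv[OF S V] immersed_surface_inj[OF S V] \<open>\<nu> \<noteq> 0\<close> this]
  show ?thesis
    by (simp add: tangent_plane_eq_range[OF S V] tangent_plane_eq_range[OF f U] \<nu>)
qed

lemma birkhoff_gauss_map_derivative_tangent:
  assumes N: "is_norm N" and f: "immersed_surface M A f" and \<eta>: "birkhoff_gauss_map N M A f \<eta>"
    and U: "(U, x) \<in> A" "q \<in> U"
  shows "chart_deriv (U, x) \<eta> q v \<in> tangent_plane A f q"
proof -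
  note A = immersed_surface_atlas[OF f]
  have UM: "U \<subseteq> M"
    by (rule chart_domain_subset[OF A U(1)])
  have smooth: "smooth_map A M \<eta>" and unit: "\<And>q. q \<in> M \<Longrightarrow> N (\<eta> q) = 1"
    and orth: "\<And>q. q \<in> M \<Longrightarrow> birkhoff_orthogonal N (\<eta> q) (tangent_plane A f q)"
    using \<eta> by (auto simp: birkhoff_gauss_map_def unit_sphere_def)
  obtain \<nu> where \<nu>: "range (chart_deriv (U, x) f q) = {w. \<nu> \<bullet> w = 0}"
    using plane_normal_exists[OF linear_chart_deriv[OF f U] immersed_surface_inj[OF f U]] by blast
  have qM: "q \<in> M"
    using UM U(2) by blast
  have "\<nu> \<bullet> chart_deriv (U, x) \<eta> q v = 0"
  proof (rule birkhoff_orthogonal_derivative[OF N, where G = "\<eta> \<circ> inv_into U x" and z = "x q" and S = "x ` U"])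
    show "birkhoff_orthogonal N ((\<eta> \<circ> inv_into U x) (x q)) {w. \<nu> \<bullet> w = 0}"
      using orth[OF qM] chart_inv_into[OF A U] by (simp add: tangent_plane_eq_range[OF f U] \<nu>)
    show "(\<eta> \<circ> inv_into U x has_derivative chart_deriv (U, x) \<eta> q) (at (x q))"
      by (rule smooth_map_chart_has_derivative[OF A smooth U qM])
    show "open (x ` U)"
      by (rule open_chart_range[OF A U(1)])
    show "N ((\<eta> \<circ> inv_into U x) z) = 1" if "z \<in> x ` U" for z
      using that chart_inv_into[OF A U(1)] UM unit by auto
  qed (use U in simp)
  then show ?thesis
    by (simp add: tangent_plane_eq_range[OF f U] \<nu>)
qed

text \<open>A differentiable map into \<open>real^3\<close> whose values lie on an embedded surface is differentiable in charts
  of that surface, and so can be composed with functions that are only defined on the surface.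
  It is needed to differentiate \<open>u \<circ> \<eta>\<close>, where \<open>u\<close> is the normal of the unit sphere.\<close>

lemma embedded_surface_map_factors:
  fixes G :: "'a::real_normed_vector \<Rightarrow> real^3" and u :: "real^3 \<Rightarrow> 'b::real_normed_vector"
  assumes S: "immersed_surface S A (\<lambda>x. x)" and V: "(V, y) \<in> A" "G z \<in> V"
    and X: "open X" "z \<in> X" "continuous_on X G" "G ` X \<subseteq> S"
    and G': "(G has_derivative G') (at z)" and u: "smooth_map A S u"
  obtains \<phi>' where "G' = chart_deriv (V, y) (\<lambda>x. x) (G z) \<circ> \<phi>'"
    and "(u \<circ> G has_derivative chart_deriv (V, y) u (G z) \<circ> \<phi>') (at z)"
proof -
  note A = immersed_surface_atlas[OF S]
  define \<psi> where "\<psi> = inv_into V y"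
  define \<phi> where "\<phi> = y \<circ> G"
  obtain T where T: "open T" "V = S \<inter> T"
    using chart_domain_openin[OF A V(1)] by (auto simp: openin_open)
  \<comment> \<open>The chart domain is only relatively open in \<open>S\<close>; since \<open>G\<close> has values in \<open>S\<close>, the points mapped into it
    still form an open set.\<close>
  define W where "W = X \<inter> G -` T"
  have "open W"
    unfolding W_def using X(1,3) T(1) by (intro continuous_open_preimage)
  have zW: "z \<in> W"
    using X(2) V(2) T(2) by (auto simp: W_def)
  have GW: "G ` W \<subseteq> V"
    using X(4) T(2) by (auto simp: W_def)
  have \<psi>\<phi>: "\<psi> (\<phi> w) = G w" if "w \<in> W" for w
    using chart_inv_into[OF A V(1)] that GW by (auto simp: \<phi>_def \<psi>_def)
  have y_cont: "continuous_on V y"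
    using A V(1) by (auto simp: smooth_atlas_def homeomorphism_def)
  have "continuous_on W \<phi>"
    unfolding \<phi>_def
    by (rule continuous_on_compose[OF continuous_on_subset[OF X(3)] continuous_on_subset[OF y_cont GW]])
      (auto simp: W_def)
  then have \<phi>_cont: "continuous (at z) \<phi>"
    using \<open>open W\<close> zW by (simp add: continuous_on_eq_continuous_at)
  have "\<phi> z = y (G z)"
    by (simp add: \<phi>_def)
  then have \<psi>': "(\<psi> has_derivative chart_deriv (V, y) (\<lambda>x. x) (G z)) (at (\<phi> z))"
    and u': "(u \<circ> \<psi> has_derivative chart_deriv (V, y) u (G z)) (at (\<phi> z))"
    using immersed_surface_chart_has_derivative[OF S V] X(2,4)
      smooth_map_chart_has_derivative[OF A u V] by (auto simp: comp_def \<psi>_def)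
  from differentiable_of_immersion_comp[OF \<phi>_cont \<psi>' immersed_surface_inj[OF S V] G' \<open>open W\<close> zW \<psi>\<phi>]
  obtain \<phi>' where \<phi>': "(\<phi> has_derivative \<phi>') (at z)"
    by (auto simp: differentiable_def)
  show thesis
  proof (rule that[of \<phi>'])
    show "G' = chart_deriv (V, y) (\<lambda>x. x) (G z) \<circ> \<phi>'"
      by (rule has_derivative_unique[OF G'],
          rule has_derivative_transform_within_open[OF diff_chain_at[OF \<phi>' \<psi>'] \<open>open W\<close> zW])
        (use \<psi>\<phi> in simp)
    show "(u \<circ> G has_derivative chart_deriv (V, y) u (G z) \<circ> \<phi>') (at z)"
      by (rule has_derivative_transform_within_open[OF diff_chain_at[OF \<phi>' u'] \<open>open W\<close> zW])
        (use \<psi>\<phi> in simp)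
  qed
qed

text \<open>Differentiating \<open>\<langle>\<xi>, \<xi>\<rangle> = 1\<close> shows that \<open>d\<xi>\<close> takes values in the tangent plane; it is then an
  endomorphism whose determinant is the Gaussian curvature.\<close>

lemma gauss_map_derivative_inj:
  assumes f: "immersed_surface M A f" and \<xi>: "euclidean_gauss_map M A f \<xi>"
    and U: "(U, x) \<in> A" "p \<in> U"
    and K: "det_on (tangent_plane A f p) (differential A f \<xi> p) \<noteq> 0"
  shows "range (chart_deriv (U, x) \<xi> p) \<subseteq> tangent_plane A f p" "inj (chart_deriv (U, x) \<xi> p)"
proof -
  note A = immersed_surface_atlas[OF f]
  have M: "U \<subseteq> M" "p \<in> M"
    using chart_domain_subset[OF A U(1)] U by auto
  have sm: "smooth_map A M \<xi>" and unit: "\<And>q. q \<in> M \<Longrightarrow> norm (\<xi> q) = 1"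
    and orth: "\<And>q v. q \<in> M \<Longrightarrow> v \<in> tangent_plane A f q \<Longrightarrow> \<xi> q \<bullet> v = 0"
    using \<xi> by (auto simp: euclidean_gauss_map_def)
  let ?E = "chart_deriv (U, x) f p" and ?D = "chart_deriv (U, x) \<xi> p"
  have D: "(\<xi> \<circ> inv_into U x has_derivative ?D) (at (x p))"
    by (rule smooth_map_chart_has_derivative[OF A sm U M(2)])
  have plane: "range ?E = {w. \<xi> p \<bullet> w = 0}"
  proof (rule range_eq_orthogonal_complement[OF linear_chart_deriv[OF f U] immersed_surface_inj[OF f U]])
    show "\<xi> p \<noteq> 0"
      using unit[OF M(2)] by auto
    show "\<xi> p \<bullet> ?E w = 0" for w
      using orth[OF M(2)] tangent_plane_eq_range[OF f U] by blast
  qed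
  have "?D v \<bullet> (\<xi> \<circ> inv_into U x) (x p) = - ((\<xi> \<circ> inv_into U x) (x p) \<bullet> ?D v)" for v
  proof (rule orthogonal_derivative[OF D D])
    show "open (x ` U)"
      by (rule open_chart_range[OF A U(1)])
    show "(\<xi> \<circ> inv_into U x) z \<bullet> (\<xi> \<circ> inv_into U x) z = 1" if "z \<in> x ` U" for z
      using that chart_inv_into[OF A U(1)] M(1) unit by (auto simp: dot_square_norm)
  qed (use U in simp)
  then have "\<xi> p \<bullet> ?D v = 0" for v
    using chart_inv_into[OF A U] by (simp add: inner_commute)
  then have sub: "range ?D \<subseteq> range ?E"
    using plane by blast
  then show "range ?D \<subseteq> tangent_plane A f p"
    by (simp add: tangent_plane_eq_range[OF f U])
  obtain Q where Q: "\<And>w. ?D w = ?E (Q *v w)"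
    using linear_factors_through_plane_basis[OF linear_chart_deriv[OF f U] immersed_surface_inj[OF f U]
        has_derivative_linear[OF D] sub] by blast
  have "differential A f \<xi> p (?E w) = ?E (Q *v w)" for w
    using differential_chart[OF f sm M(2) U] Q by simp
  from det_on_eq_and_trace_on_eq(1)[OF linear_chart_deriv[OF f U] immersed_surface_inj[OF f U]
      tangent_plane_eq_range[OF f U, symmetric] this] K
  have "invertible Q"
    by (simp add: invertible_det_nz)
  then have "inj ((*v) Q)"
    by (rule inj_matrix_vector_mult)
  moreover have "?D = ?E \<circ> (*v) Q"
    by (auto simp: Q)
  ultimately show "inj ?D"
    using inj_compose[OF immersed_surface_inj[OF f U]] by simp
qed

text \<open>Differentiating \<open>\<langle>g\<^sub>i, \<xi>\<rangle> = 0\<close> gives \<open>\<langle>g\<^sub>i, \<xi>\<^sub>j\<rangle> = -\<langle>g\<^sub>i\<^sub>j, \<xi>\<rangle>\<close>. For \<open>g = f\<close> this is the symmetry of the affine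
  form, for \<open>g = \<eta>\<close> the self-adjointness of \<open>d\<eta>\<close> with respect to it.\<close>

lemma normal_derivative_symmetric:
  fixes g \<xi> :: "'m::{t2_space,second_countable_topology} \<Rightarrow> 'b::euclidean_space"
  assumes A: "smooth_atlas M A" and U: "(U, x) \<in> A" "p \<in> U" and g: "smooth_map A M g"
    and \<xi>': "(\<xi> \<circ> inv_into U x has_derivative \<Xi>') (at (x p))"
    and orth: "\<And>q v. q \<in> U \<Longrightarrow> chart_deriv (U, x) g q v \<bullet> \<xi> q = 0"
  shows "chart_deriv (U, x) g p v \<bullet> \<Xi>' w = chart_deriv (U, x) g p w \<bullet> \<Xi>' v"
proof -
  let ?g = "g \<circ> inv_into U x"
  let ?g' = "\<lambda>v z. frechet_derivative ?g (at z) v"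
  let ?g'' = "\<lambda>v. frechet_derivative (?g' v) (at (x p))"
  have "U \<inter> M = U"
    using chart_domain_subset[OF A U(1)] by blast
  then have C2: "Ck_on (Suc (Suc 0)) (x ` U) ?g"
    using smooth_map_chart[OF g U(1)] by metis
  have op: "open (x ` U)" and mem: "x p \<in> x ` U"
    using open_chart_range[OF A U(1)] U(2) by simp_all
  have inv: "inv_into U x (x p) = p"
    by (rule chart_inv_into[OF A U])
  have eq: "?g'' v w \<bullet> \<xi> p = - (chart_deriv (U, x) g p v \<bullet> \<Xi>' w)" for v w
  proof -
    have "?g'' v w \<bullet> (\<xi> \<circ> inv_into U x) (x p) = - (?g' v (x p) \<bullet> \<Xi>' w)"
    proof (rule orthogonal_derivative[OF _ \<xi>' op mem])
      show "(?g' v has_derivative ?g'' v) (at (x p))"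
        using C2 by (intro Ck_on_has_derivative[OF _ mem, of 0]) simp
      show "?g' v z \<bullet> (\<xi> \<circ> inv_into U x) z = 0" if "z \<in> x ` U" for z
        using that orth chart_inv_into[OF A U(1)] by (auto simp: chart_deriv_def)
    qed
    then show ?thesis
      by (simp add: inv chart_deriv_def)
  qed
  have "?g'' v w = ?g'' w v"
    by (rule symmetric_second_derivative[OF op mem C2])
  with eq[of v w] eq[of w v] show ?thesis
    by simp
qed

text \<open>The geometry at \<open>p\<close> in coordinates: \<open>E\<close> is the differential of \<open>f\<close> in a chart, \<open>Q\<close> the
  matrix of \<open>d\<eta>\<^sub>p\<close> and \<open>b\<close> the affine form. With \<open>\<xi> = u \<circ> \<eta>\<close>, a vector \<open>w\<close> in the kernel of \<open>b\<close> has \<open>d\<xi> w\<close>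
  both tangent and orthogonal to the tangent plane, hence zero; as \<open>du\<close> and \<open>Q\<close> are injective, \<open>w = 0\<close>.\<close>

lemma birkhoff_gauss_map_shape:
  fixes M :: "'m::{t2_space,second_countable_topology} set"
  assumes N: "admissible_norm N" and f: "immersed_surface M A f"
    and \<eta>: "birkhoff_gauss_map N M A f \<eta>" and p: "p \<in> M"
    and K: "minkowski_gauss_curvature A f \<eta> p \<noteq> 0"
  obtains E :: "real^2 \<Rightarrow> real^3" and Q :: "real^2^2" and b :: "real^2 \<Rightarrow> real^2 \<Rightarrow> real"
  where "linear E" "inj E" "range E = tangent_plane A f p"
    and "\<And>v. differential A f \<eta> p (E v) = E (Q *v v)"
    and "\<And>v w. affine_form M A f \<eta> p (E v) (E w) = b v w"
    and "bilinear b" "\<And>w. (\<And>v. b v w = 0) \<Longrightarrow> w = 0"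
    and "\<And>v w. b (Q *v v) w = b v (Q *v w)"
proof -
  obtain A' u where S: "immersed_surface (unit_sphere N) A' (\<lambda>x. x)"
    and u: "euclidean_gauss_map (unit_sphere N) A' (\<lambda>x. x) u"
    and Ku: "\<And>s. s \<in> unit_sphere N \<Longrightarrow>
      0 < det_on (tangent_plane A' (\<lambda>x. x) s) (differential A' (\<lambda>x. x) u s)"
    and "is_norm N"
    using N unfolding admissible_norm_def by blast
  note A = immersed_surface_atlas[OF f] and A' = immersed_surface_atlas[OF S]
  have u_unit: "\<And>s. s \<in> unit_sphere N \<Longrightarrow> norm (u s) = 1"
    and u_orth: "\<And>s v. s \<in> unit_sphere N \<Longrightarrow> v \<in> tangent_plane A' (\<lambda>x. x) s \<Longrightarrow> u s \<bullet> v = 0"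
    and u_smooth: "smooth_map A' (unit_sphere N) u"
    using u by (auto simp: euclidean_gauss_map_def)
  have \<eta>_smooth: "smooth_map A M \<eta>"
    and \<eta>_unit: "\<And>q. q \<in> M \<Longrightarrow> \<eta> q \<in> unit_sphere N"
    and \<eta>_orth: "\<And>q. q \<in> M \<Longrightarrow> birkhoff_orthogonal N (\<eta> q) (tangent_plane A f q)"
    using \<eta> by (auto simp: birkhoff_gauss_map_def)
  note parallel = unit_sphere_tangent_plane_eq[OF \<open>is_norm N\<close> S f \<eta>]
  \<comment> \<open>The tangent planes of \<open>M\<close> at \<open>q\<close> and of the sphere at \<open>\<eta> q\<close> agree, so the normal of the sphere
    serves as a unit normal of \<open>M\<close>.\<close>
  define \<xi> where "\<xi> q = u (\<eta> q)" for q
  have normal: "v \<bullet> \<xi> q = 0" if "q \<in> M" "v \<in> tangent_plane A f q" for q v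
    using u_orth[OF \<eta>_unit[OF that(1)]] that(2) parallel[OF that(1)]
    by (simp add: \<xi>_def inner_commute)
  obtain U x where U: "(U, x) \<in> A" "p \<in> U"
    using immersed_surface_chart_around[OF f p] .
  obtain V y where V: "(V, y) \<in> A'" "\<eta> p \<in> V"
    using immersed_surface_chart_around[OF S \<eta>_unit[OF p]] .
  have UM: "U \<subseteq> M"
    using chart_domain_subset[OF A U(1)] .
  define E where "E = chart_deriv (U, x) f p"
  define G' where "G' = chart_deriv (U, x) \<eta> p"
  define u' where "u' = chart_deriv (V, y) u (\<eta> p)"
  have E: "linear E" "inj E" "range E = tangent_plane A f p"
    unfolding E_def using linear_chart_deriv[OF f U] immersed_surface_inj[OF f U]
      tangent_plane_eq_range[OF f U] by simp_all
  have plane: "range E = {w. \<xi> p \<bullet> w = 0}"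
  proof (rule range_eq_orthogonal_complement[OF E(1,2)])
    show "\<xi> p \<noteq> 0"
      using u_unit[OF \<eta>_unit[OF p]] by (auto simp: \<xi>_def)
    show "\<xi> p \<bullet> E w = 0" for w
      using normal[OF p, of "E w"] E(3) by (auto simp: inner_commute)
  qed
  have transversal: "\<eta> p \<bullet> \<xi> p \<noteq> 0"
    using birkhoff_orthogonal_supports(1)[OF \<open>is_norm N\<close>, of "\<eta> p" "\<xi> p"] \<eta>_unit[OF p] \<eta>_orth[OF p] plane E(3)
    by (simp add: unit_sphere_def inner_commute)

  let ?G = "\<eta> \<circ> inv_into U x"
  have Gz: "?G (x p) = \<eta> p"
    using chart_inv_into[OF A U] by simp
  have G': "(?G has_derivative G') (at (x p))"
    unfolding G'_def by (rule smooth_map_chart_has_derivative[OF A \<eta>_smooth U p])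
  have G_cont: "continuous_on (x ` U) ?G"
    using smooth_map_chart[OF \<eta>_smooth U(1), of 0] UM by (simp add: Int_absorb2)
  have G_unit: "?G ` (x ` U) \<subseteq> unit_sphere N"
    using chart_inv_into[OF A U(1)] UM \<eta>_unit by auto
  obtain \<phi>' where G'_eq: "G' = chart_deriv (V, y) (\<lambda>x. x) (?G (x p)) \<circ> \<phi>'"
    and \<xi>': "(u \<circ> ?G has_derivative chart_deriv (V, y) u (?G (x p)) \<circ> \<phi>') (at (x p))"
    using embedded_surface_map_factors[OF S V(1) _ open_chart_range[OF A U(1)] _ G_cont G_unit G' u_smooth]
      U(2) V(2) Gz by (metis imageI)
  define \<Xi>' where "\<Xi>' = u' \<circ> \<phi>'"
  have \<xi>_chart: "\<xi> \<circ> inv_into U x = u \<circ> ?G"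
    by (simp add: \<xi>_def fun_eq_iff)
  have \<Xi>': "(\<xi> \<circ> inv_into U x has_derivative \<Xi>') (at (x p))"
    using \<xi>' unfolding Gz \<xi>_chart \<Xi>'_def u'_def .
  have u'_linear: "linear u'"
    unfolding u'_def
    by (rule has_derivative_linear[OF smooth_map_chart_has_derivative[OF A' u_smooth V \<eta>_unit[OF p]]])
  have u'_props: "range u' \<subseteq> tangent_plane A f p" "inj u'"
    using gauss_map_derivative_inj[OF S u V] Ku[OF \<eta>_unit[OF p]] parallel[OF p]
    by (simp_all add: u'_def)

  note \<eta>_tangent = birkhoff_gauss_map_derivative_tangent[OF \<open>is_norm N\<close> f \<eta> U(1)]
  have "range G' \<subseteq> range E"
    using \<eta>_tangent[OF U(2)] E(3) by (auto simp: G'_def)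
  then obtain Q where Q: "\<And>w. G' w = E (Q *v w)"
    using linear_factors_through_plane_basis[OF E(1,2) has_derivative_linear[OF G']] by blast
  have diff: "differential A f \<eta> p (E v) = E (Q *v v)" for v
    using differential_chart[OF f \<eta>_smooth p U, of v] Q by (simp add: E_def G'_def)
  have "det Q \<noteq> 0"
    using K det_on_eq_and_trace_on_eq(1)[OF E diff] by (simp add: minkowski_gauss_curvature_def)

  define b where "b v w = - (E w \<bullet> \<Xi>' v) / (\<eta> p \<bullet> \<xi> p)" for v w
  have form: "affine_form M A f \<eta> p (E v) (E w) = b v w" for v w
    unfolding b_def E_def by (rule affine_form_chart[where \<xi> = \<xi> and \<eta> = \<eta> and p = p, OF f U \<Xi>' normal transversal])
  have lin: "linear \<Xi>'"
    by (rule has_derivative_linear[OF \<Xi>'])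
  have bil: "bilinear b"
    unfolding bilinear_def b_def
    by (auto intro!: linearI simp: linear_add[OF E(1)] linear_scale[OF E(1)] linear_add[OF lin]
        linear_scale[OF lin] inner_add_left inner_add_right diff_divide_distrib add_divide_distrib)
  have E_sym: "E v \<bullet> \<Xi>' w = E w \<bullet> \<Xi>' v" for v w
    unfolding E_def
  proof (rule normal_derivative_symmetric[OF A U immersed_surface_smooth[OF f] \<Xi>'])
    show "chart_deriv (U, x) f q v \<bullet> \<xi> q = 0" if "q \<in> U" for q v
      using that UM tangent_plane_eq_range[OF f U(1) that] by (intro normal) auto
  qed
  have G_sym: "G' v \<bullet> \<Xi>' w = G' w \<bullet> \<Xi>' v" for v w
    unfolding G'_def
  proof (rule normal_derivative_symmetric[OF A U \<eta>_smooth \<Xi>'])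
    show "chart_deriv (U, x) \<eta> q v \<bullet> \<xi> q = 0" if "q \<in> U" for q v
      using that UM \<eta>_tangent by (intro normal) auto
  qed
  have adj: "b (Q *v v) w = b v (Q *v w)" for v w
    unfolding b_def using G_sym[of v w] by (simp add: E_sym[of w "Q *v v"] Q)
  have nondeg: "w = 0" if "\<And>v. b v w = 0" for w
  proof -
    have "E v \<bullet> \<Xi>' w = 0" for v
      using that[of v] transversal E_sym[of v w] by (simp add: b_def)
    moreover obtain v where "\<Xi>' w = E v"
      using u'_props(1) E(3) by (auto simp: \<Xi>'_def)
    ultimately have "\<Xi>' w = 0"
      by (metis inner_eq_zero_iff)
    then have "u' (\<phi>' w) = u' 0"
      using linear_0[OF u'_linear] by (simp add: \<Xi>'_def)
    then have "\<phi>' w = 0"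
      by (rule injD[OF u'_props(2)])
    then have "E (Q *v w) = 0"
      using Q[of w] linear_0[OF linear_chart_deriv[OF S V]] by (simp add: G'_eq[unfolded Gz])
    then have "E (Q *v w) = E (Q *v 0)"
      by (simp add: linear_0[OF E(1)])
    then have "Q *v w = Q *v 0"
      by (rule injD[OF E(2)])
    moreover have "inj ((*v) Q)"
      using \<open>det Q \<noteq> 0\<close> by (intro inj_matrix_vector_mult) (simp add: invertible_det_nz)
    ultimately show "w = 0"
      by (metis injD)
  qed
  show thesis
    using that[OF E diff form bil nondeg adj] .
qed

lemma conformal_iff_minimal_at:
  fixes M :: "'m::{t2_space,second_countable_topology} set"
  assumes "admissible_norm N" "immersed_surface M A f" "birkhoff_gauss_map N M A f \<eta>" "p \<in> M"
    and K: "minkowski_gauss_curvature A f \<eta> p < 0"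
  shows "(\<forall>X\<in>tangent_plane A f p. \<forall>Y\<in>tangent_plane A f p.
        affine_form M A f \<eta> p (differential A f \<eta> p X) (differential A f \<eta> p Y) =
          c * affine_form M A f \<eta> p X Y) \<longleftrightarrow>
    minkowski_mean_curvature A f \<eta> p = 0 \<and> c = - minkowski_gauss_curvature A f \<eta> p"
proof -
  have "minkowski_gauss_curvature A f \<eta> p \<noteq> 0"
    using K by simp
  from birkhoff_gauss_map_shape[OF assms(1-4) this]
  obtain E :: "real^2 \<Rightarrow> real^3" and Q :: "real^2^2" and b :: "real^2 \<Rightarrow> real^2 \<Rightarrow> real"
    where E: "linear E" "inj E" "range E = tangent_plane A f p"
      and Q: "\<And>v. differential A f \<eta> p (E v) = E (Q *v v)"
      and form: "\<And>v w. affine_form M A f \<eta> p (E v) (E w) = b v w"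
      and b: "bilinear b" "\<And>w. (\<And>v. b v w = 0) \<Longrightarrow> w = 0" "\<And>v w. b (Q *v v) w = b v (Q *v w)"
    by metis
  have K_eq: "minkowski_gauss_curvature A f \<eta> p = det Q"
    and H_eq: "minkowski_mean_curvature A f \<eta> p = trace Q / 2"
    using det_on_eq_and_trace_on_eq[OF E Q]
    by (simp_all add: minkowski_gauss_curvature_def minkowski_mean_curvature_def)
  have "(\<forall>v w. b (Q *v v) (Q *v w) = c * b v w) \<longleftrightarrow> trace Q = 0 \<and> c = - det Q"
    using K by (intro self_adjoint_conformal_iff b) (simp_all add: K_eq)
  then show ?thesis
    unfolding E(3)[symmetric] by (simp add: Q form K_eq H_eq)
qed

theorem proposition2p1:
  fixes N :: "real^3 \<Rightarrow> real"
    and M :: "'m::{t2_space,second_countable_topology} set"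
    and A :: "'m chart set"
    and f \<eta> :: "'m \<Rightarrow> real^3"
  assumes "admissible_norm N"
    and "immersed_surface M A f"
    and "birkhoff_gauss_map N M A f \<eta>"
    and "\<forall>p\<in>M. minkowski_gauss_curvature A f \<eta> p < 0"
  shows "(minkowski_minimal M A f \<eta> \<longleftrightarrow>
           (\<exists>c :: 'm \<Rightarrow> real. \<forall>p\<in>M. \<forall>X\<in>tangent_plane A f p. \<forall>Y\<in>tangent_plane A f p.
              affine_form M A f \<eta> p (differential A f \<eta> p X) (differential A f \<eta> p Y) =
                c p * affine_form M A f \<eta> p X Y)) \<and>
         (\<forall>c :: 'm \<Rightarrow> real.
           (\<forall>p\<in>M. \<forall>X\<in>tangent_plane A f p. \<forall>Y\<in>tangent_plane A f p.
              affine_form M A f \<eta> p (differential A f \<eta> p X) (differential A f \<eta> p Y) =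
                c p * affine_form M A f \<eta> p X Y) \<longrightarrow>
           (\<forall>p\<in>M. c p = - minkowski_gauss_curvature A f \<eta> p))"
proof -
  have "(\<forall>p\<in>M. \<forall>X\<in>tangent_plane A f p. \<forall>Y\<in>tangent_plane A f p.
        affine_form M A f \<eta> p (differential A f \<eta> p X) (differential A f \<eta> p Y) =
          c p * affine_form M A f \<eta> p X Y) \<longleftrightarrow>
      (\<forall>p\<in>M. minkowski_mean_curvature A f \<eta> p = 0 \<and> c p = - minkowski_gauss_curvature A f \<eta> p)" for c
    by (rule ball_cong[OF refl conformal_iff_minimal_at[OF assms(1-3)]]) (use assms(4) in blast)+
  then show ?thesis
    unfolding minkowski_minimal_def by auto
qed

end
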